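(* Let $m\ge0$ be a fixed integer. Let $(\theta_p)_{p \text{ prime}}$ be independent identically distributed random variables with values in $(0,\pi)$ satisfying $\mathbb{P}(\alpha<\theta_p<\beta)=\frac{2}{\pi}\int_\alpha^\beta\sin^2\theta\,d\theta$ for $0\le\alpha<\beta\le\pi$. Let $\varrho$ be the (random) multiplicative function with $\varrho(1)=1$, $\varrho(p)=2p^{m/2}\cos\theta_p$ and \[ \varrho(p^{k+1})=\varrho(p)\varrho(p^{k})-p^{m}\varrho(p^{k-1}),\quad k\ge1, \] for every prime $p$. Put $I_x^{(m)}=\sum_{n\le x}\varrho(n)/n^{(m+2)/2}$. Then \[ \mathbb{P}(I_x^{(m)}<0)=O\left(\exp\left(-\exp\left(\frac{\ln x}{C\ln_{2}x}\right)\right)\right), \] where $C$ is a positive constant depending on $m$.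
   Context: $\ln_2 x=\ln\ln x$. *)

theory Defs
  imports "HOL-Probability.Probability" "HOL-Library.Landau_Symbols"
    "HOL-Computational_Algebra.Primes"
begin

text \<open>
  The random variables are indexed by \<^typ>\<open>nat\<close>; only the values at primes matter.
  The interval formula determines the law of each variable, so it also expresses that they
  are identically distributed. Measurability is part of \<^const>\<open>prob_space.indep_vars\<close>.
\<close>

definition sato_tate_family :: "'a measure \<Rightarrow> (nat \<Rightarrow> 'a \<Rightarrow> real) \<Rightarrow> bool" where
  "sato_tate_family M \<theta> \<longleftrightarrow>
     prob_space.indep_vars M (\<lambda>_. borel) \<theta> {p. prime p} \<and>
     (\<forall>p. prime p \<longrightarrow> (\<forall>\<omega>\<in>space M. 0 < \<theta> p \<omega> \<and> \<theta> p \<omega> < pi)) \<and>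
     (\<forall>p. prime p \<longrightarrow> (\<forall>\<alpha> \<beta>. 0 \<le> \<alpha> \<and> \<alpha> < \<beta> \<and> \<beta> \<le> pi \<longrightarrow>
        measure M {\<omega> \<in> space M. \<alpha> < \<theta> p \<omega> \<and> \<theta> p \<omega> < \<beta>} =
          2 / pi * integral {\<alpha>..\<beta>} (\<lambda>t. (sin t)\<^sup>2)))"

definition multiplicative :: "(nat \<Rightarrow> real) \<Rightarrow> bool" where
  "multiplicative f \<longleftrightarrow>
     f 1 = 1 \<and> (\<forall>a b. a > 0 \<and> b > 0 \<and> coprime a b \<longrightarrow> f (a * b) = f a * f b)"

text \<open>Nothing is required of the value of \<open>f\<close> at \<open>0\<close>, which is never used.\<close>

definition hecke_function :: "nat \<Rightarrow> (nat \<Rightarrow> real) \<Rightarrow> (nat \<Rightarrow> real) \<Rightarrow> bool" where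
  "hecke_function m t f \<longleftrightarrow>
     multiplicative f \<and>
     (\<forall>p. prime p \<longrightarrow> f p = 2 * real p powr (real m / 2) * cos (t p)) \<and>
     (\<forall>p k. prime p \<and> k \<ge> 1 \<longrightarrow>
        f (p ^ (k + 1)) = f p * f (p ^ k) - real p ^ m * f (p ^ (k - 1)))"

definition partial_sum :: "nat \<Rightarrow> (nat \<Rightarrow> real) \<Rightarrow> real \<Rightarrow> real" where
  "partial_sum m f x = (\<Sum>n\<in>{1..nat \<lfloor>x\<rfloor>}. f n / real n powr ((real m + 2) / 2))"

end

theory Submission
  imports Defs "HOL-Real_Asymp.Real_Asymp"
begin

text \<open>
  Dividing \<open>\<rho>(n)\<close> by \<open>n\<^sup>m\<^sup>/\<^sup>2\<close> gives a multiplicative function \<open>\<lambda>\<close> with \<open>\<lambda>(p\<^sup>k) = U\<^sub>k(cos \<theta>\<^sub>p)\<close>,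
  and \<open>I\<^sub>x\<close> is the sum of \<open>\<lambda>(n)/n\<close> over \<open>n \<le> x\<close>. Let \<open>w = exp (ln x / (80 ln ln x))\<close>. The
  \<open>w\<close>-friable \<open>n\<close> contribute, for every value of the angles, at least the Euler product over
  \<open>p \<le> w\<close> minus a tail; the product is at least a power of \<open>1 / ln x\<close>, and by Rankin's trick
  the tail is a smaller power. The rest of the sum, split according to the largest prime factor
  \<open>p > w\<close> of \<open>n\<close>, is a sum of martingale differences, because \<open>U\<^sub>k(cos \<theta>\<^sub>p)\<close> has mean zero for
  \<open>k \<ge> 1\<close>. The difference at \<open>p\<close> is bounded by a power of \<open>ln x\<close> divided by \<open>p\<close>, so an
  exponential moment estimate of Azuma type bounds the probability that the rest exceeds the
  friable part by \<open>exp (- w\<^sup>1\<^sup>/\<^sup>4)\<close>. Prime sums only need Chebyshev's upper bound.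
\<close>

section \<open>Sums of reciprocals of primes\<close>

lemma prod_primes_dvd:
  fixes S :: "nat set" and N :: nat
  assumes "finite S" "\<And>p. p \<in> S \<Longrightarrow> prime p \<and> p dvd N"
  shows "\<Prod>S dvd N"
  using assms
proof (induction S rule: finite_induct)
  case (insert p S)
  have "coprime p q" if "q \<in> S" for q
    using insert.hyps insert.prems that by (metis insertCI primes_coprime)
  then have "coprime p (\<Prod>S)" by (intro prod_coprime_right) auto
  then show ?case using insert by (simp add: divides_mult)
qed simp

text \<open>A prime in \<open>(n, 2 * n]\<close> occurs in the numerator \<open>fact (2 * n)\<close>
  but in neither factor \<open>fact n\<close> of the denominator.\<close>

lemma prime_dvd_central_binomial:
  fixes p n :: nat
  assumes "prime p" "n < p" "p \<le> 2 * n"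
  shows "p dvd (2 * n) choose n"
proof -
  have "fact n * fact n * ((2 * n) choose n) = (fact (2 * n) :: nat)"
    using binomial_fact_lemma[of n "2 * n"] by (simp add: mult_2)
  moreover have "p dvd fact (2 * n)" using assms by (simp add: prime_dvd_fact_iff)
  moreover have "\<not> p dvd fact n" using assms by (simp add: prime_dvd_fact_iff)
  ultimately show ?thesis using assms(1) by (metis prime_dvd_multD)
qed

text \<open>The product of the primes in the block divides the central binomial coefficient of
  \<open>2 ^ j\<close>, which is at most \<open>2 ^ (2 * 2 ^ j)\<close>. Each prime exceeds
  \<open>2 ^ j\<close>, so comparing exponents leaves at most \<open>2 * 2 ^ j / j\<close> primes,
  each with reciprocal below \<open>1 / 2 ^ j\<close>.\<close>

lemma sum_inverse_primes_dyadic: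
  fixes j :: nat
  assumes "j \<ge> 1"
  shows "(\<Sum>p | prime p \<and> 2 ^ j < p \<and> p \<le> 2 ^ Suc j. 1 / real p) \<le> 2 / j"
proof -
  define S where "S = {p::nat. prime p \<and> 2 ^ j < p \<and> p \<le> 2 ^ Suc j}"
  have fin: "finite S" by (rule finite_subset[of _ "{..2 ^ Suc j}"]) (auto simp: S_def)
  have "(2 ^ j) ^ card S = (\<Prod>p\<in>S. 2 ^ j :: nat)" by simp
  also have "\<dots> \<le> \<Prod>S" by (intro prod_mono) (auto simp: S_def)
  also have "\<dots> \<le> (2 * 2 ^ j) choose (2 ^ j)"
    by (intro dvd_imp_le prod_primes_dvd fin)
       (auto simp: S_def zero_less_binomial_iff intro!: prime_dvd_central_binomial)
  also have "\<dots> \<le> 2 ^ (2 * 2 ^ j)" by (rule binomial_le_pow2)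
  finally have "(2::nat) ^ (j * card S) \<le> 2 ^ (2 * 2 ^ j)" by (simp add: power_mult)
  then have "j * card S \<le> 2 * 2 ^ j" by (simp add: power_increasing_iff)
  then have "real (j * card S) \<le> real (2 * 2 ^ j)" by (rule of_nat_mono)
  then have card: "real j * card S \<le> 2 * 2 ^ j" by simp
  have "(\<Sum>p\<in>S. 1 / real p) \<le> (\<Sum>p\<in>S. 1 / 2 ^ j)"
  proof (intro sum_mono)
    fix p assume "p \<in> S"
    then have "real (2 ^ j) \<le> real p" unfolding S_def of_nat_le_iff by simp
    then show "1 / real p \<le> 1 / 2 ^ j" by (intro frac_le) auto
  qed
  also have "\<dots> = card S / 2 ^ j" by simp
  also have "\<dots> \<le> 2 / j" using card assms by (simp add: field_simps)
  finally show ?thesis by (simp add: S_def)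
qed

section \<open>Passage from dyadic blocks to all primes up to a bound\<close>

definition primes_upto :: "nat \<Rightarrow> nat set" where
  "primes_upto n = {p. prime p \<and> p \<le> n}"

lemma finite_primes_upto [simp, intro]: "finite (primes_upto n)"
  by (rule finite_subset[of _ "{..n}"]) (auto simp: primes_upto_def)

lemma primes_upto_Suc:
  "primes_upto (Suc n) = (if prime (Suc n) then insert (Suc n) (primes_upto n) else primes_upto n)"
  by (auto simp: primes_upto_def le_Suc_eq)

lemma primes_upto_mono: "m \<le> n \<Longrightarrow> primes_upto m \<subseteq> primes_upto n"
  by (auto simp: primes_upto_def)

text \<open>The dyadic bounds \<open>2 / j\<close> are summed by comparison with a logarithm:
  \<open>ln u \<le> u - 1\<close> at \<open>u = 1 - 1 / J\<close> bounds \<open>1 / J\<close> by an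
  increment of \<open>ln\<close>. The additive constant is generous; the initial sum is only
  \<open>1 / 2 + 1 / 3\<close>.\<close>

lemma sum_inverse_primes_pow2:
  "J \<ge> 2 \<Longrightarrow> (\<Sum>p\<in>primes_upto (2 ^ J). 1 / real p) \<le> 5 / 2 + 2 * ln (real J - 1)"
proof (induction J rule: dec_induct)
  case base
  have "primes_upto 4 \<subseteq> {2, 3}"
  proof
    fix p :: nat assume p: "p \<in> primes_upto 4"
    have "\<not> prime (4::nat)" by (auto simp: prime_nat_iff intro!: exI[of _ 2])
    with p have "p \<noteq> 4" by (auto simp: primes_upto_def)
    then show "p \<in> {2, 3}" using p prime_ge_2_nat[of p] by (auto simp: primes_upto_def)
  qed
  then have "(\<Sum>p\<in>primes_upto 4. 1 / real p) \<le> (\<Sum>p\<in>{2,3}. 1 / real p)"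
    by (intro sum_mono2) auto
  then show ?case by simp
next
  case (step J)
  have step_ln: "1 / J \<le> ln (real J) - ln (real J - 1)"
  proof -
    have "ln ((real J - 1) / J) \<le> (real J - 1) / J - 1"
      using step by (intro ln_le_minus_one) auto
    moreover have "ln ((real J - 1) / J) = ln (real J - 1) - ln (real J)"
      using step by (subst ln_div) auto
    moreover have "(real J - 1) / J = 1 - 1 / J" using step by (simp add: field_simps)
    ultimately show ?thesis by linarith
  qed
  have "primes_upto (2 ^ Suc J) =
      primes_upto (2 ^ J) \<union> {p. prime p \<and> 2 ^ J < p \<and> p \<le> 2 ^ Suc J}"
    by (auto simp: primes_upto_def)
  then have "(\<Sum>p\<in>primes_upto (2 ^ Suc J). 1 / real p) = (\<Sum>p\<in>primes_upto (2 ^ J). 1 / real p)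
      + (\<Sum>p | prime p \<and> 2 ^ J < p \<and> p \<le> 2 ^ Suc J. 1 / real p)"
    by (simp only:, intro sum.union_disjoint)
       (auto simp: primes_upto_def intro: finite_subset[of _ "{..2 ^ Suc J}"])
  also have "\<dots> \<le> 5 / 2 + 2 * ln (real J - 1) + 2 / J"
    using step by (intro add_mono sum_inverse_primes_dyadic) auto
  also have "\<dots> \<le> 5 / 2 + 2 * ln (real (Suc J) - 1)" using step_ln by simp
  finally show ?case .
qed

text \<open>The dyadic argument gives leading constant \<open>2\<close>; rounding it up to
  \<open>3\<close> absorbs the additive constant and the change to base \<open>2\<close>.\<close>

lemma sum_inverse_primes_bound:
  "\<forall>\<^sub>F x in at_top. (\<Sum>p\<in>primes_upto (nat \<lfloor>x\<rfloor>). 1 / real p) \<le> 3 * ln (ln x)"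
proof -
  have "\<forall>\<^sub>F x::real in at_top. 5 / 2 + 2 * ln (log 2 x + 1) \<le> 3 * ln (ln x)"
    by real_asymp
  moreover have "\<forall>\<^sub>F x::real in at_top. x \<ge> 4" by (rule eventually_ge_at_top)
  ultimately show ?thesis
  proof eventually_elim
    case (elim x)
    define J where "J = nat \<lceil>log 2 x\<rceil>"
    have log: "2 \<le> log 2 x" using elim le_log_iff[of 2 x 2] by (simp add: powr_numeral)
    then have J: "log 2 x \<le> J" "J \<le> log 2 x + 1" unfolding J_def by linarith+
    with log have J2: "J \<ge> 2" by linarith
    have "x = 2 powr (log 2 x)" using elim by simp
    also have "\<dots> \<le> 2 powr J" using J by (intro powr_mono) auto
    finally have "x \<le> 2 ^ J" by (simp add: powr_realpow)
    then have "nat \<lfloor>x\<rfloor> \<le> 2 ^ J" by (simp add: nat_le_iff floor_le_iff le_less_trans)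
    then have "(\<Sum>p\<in>primes_upto (nat \<lfloor>x\<rfloor>). 1 / real p) \<le> (\<Sum>p\<in>primes_upto (2 ^ J). 1 / real p)"
      by (intro sum_mono2 primes_upto_mono) auto
    also have "\<dots> \<le> 5 / 2 + 2 * ln (real J - 1)" by (rule sum_inverse_primes_pow2[OF J2])
    also have "\<dots> \<le> 5 / 2 + 2 * ln (log 2 x + 1)" using J J2 by simp
    finally show ?case using elim by simp
  qed
qed

section \<open>Chebyshev polynomials of the second kind\<close>

text \<open>Dividing \<open>f (p ^ k)\<close> by \<open>p powr (m * k / 2)\<close> turns the Hecke
  recurrence into this one, with \<open>c = cos (t p)\<close>.\<close>

fun cheb_U :: "nat \<Rightarrow> real \<Rightarrow> real" where
  "cheb_U 0 c = 1"
| "cheb_U (Suc 0) c = 2 * c"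
| "cheb_U (Suc (Suc k)) c = 2 * c * cheb_U (Suc k) c - cheb_U k c"

text \<open>The classical quotient formula, kept in product form so that zeros of
  \<open>sin x\<close> need no separate treatment.\<close>

lemma sin_times_cheb_U: "sin x * cheb_U k (cos x) = sin (real (Suc k) * x)"
proof (induction k "cos x" rule: cheb_U.induct)
  case (3 k)
  have "sin x * cheb_U (Suc (Suc k)) (cos x)
      = 2 * cos x * sin (real (Suc (Suc k)) * x) - sin (real (Suc k) * x)"
    using 3 by (simp only: cheb_U.simps right_diff_distrib) (simp add: algebra_simps)
  also have "\<dots> = sin (real (Suc (Suc (Suc k))) * x)"
    using sin_add[of "real (Suc (Suc k)) * x" x] sin_diff[of "real (Suc (Suc k)) * x" x]
    by (simp add: algebra_simps)
  finally show ?case .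
qed (simp_all add: sin_double)

text \<open>This first-order recurrence shows that the size at \<open>cos x\<close> grows by at most
  \<open>1\<close> per step, which gives the linear bound below without dividing by
  \<open>sin x\<close>.\<close>

lemma cheb_U_Suc_cos:
  "cheb_U (Suc k) (cos x) = cos x * cheb_U k (cos x) + cos (real (Suc k) * x)"
proof (induction k)
  case (Suc k)
  have "cos x * cheb_U (Suc k) (cos x) - cheb_U k (cos x)
      = cos x * cos (real (Suc k) * x) - (sin x * sin x) * cheb_U k (cos x)"
  proof -
    have "sin x * sin x = 1 - cos x * cos x"
      using sin_cos_squared_add[of x] by (simp add: power2_eq_square)
    then show ?thesis by (simp only: Suc) (simp add: algebra_simps)
  qed
  also have "\<dots> = cos x * cos (real (Suc k) * x) - sin x * sin (real (Suc k) * x)"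
    by (simp only: mult.assoc sin_times_cheb_U)
  also have "\<dots> = cos (real (Suc (Suc k)) * x)"
    using cos_add[of "real (Suc k) * x" x] by (simp add: algebra_simps)
  finally show ?case by simp
qed simp

lemma abs_cheb_U_cos_le: "\<bar>cheb_U k (cos x)\<bar> \<le> real k + 1"
proof (induction k)
  case (Suc k)
  have "\<bar>cheb_U (Suc k) (cos x)\<bar> \<le> \<bar>cos x\<bar> * \<bar>cheb_U k (cos x)\<bar> + \<bar>cos (real (Suc k) * x)\<bar>"
    unfolding cheb_U_Suc_cos abs_mult[symmetric] by (rule abs_triangle_ineq)
  also have "\<dots> \<le> 1 * (real k + 1) + 1"
    using Suc by (intro add_mono mult_mono) auto
  finally show ?case by simp
qed simp

text \<open>Truncated generating function: the recurrence cancels every coefficient except the first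
  and the two at the cut.\<close>

lemma sum_cheb_U_geometric:
  "(\<Sum>k\<le>K. cheb_U k c * r ^ k) * (1 - 2 * c * r + r\<^sup>2)
     = 1 - cheb_U (Suc K) c * r ^ Suc K + cheb_U K c * r ^ (K + 2)"
proof (induction K)
  case (Suc K)
  show ?case by (simp add: Suc distrib_right) (simp add: algebra_simps power2_eq_square)
qed (simp add: algebra_simps power2_eq_square)

lemma borel_measurable_cheb_U [measurable]: "cheb_U k \<in> borel_measurable borel"
\<comment> \<open>The point \<open>0\<close> is a dummy: the induction rule carries the argument
  along, but the claim concerns only the index.\<close>
proof (induction k "0 :: real" rule: cheb_U.induct)
  case (3 k)
  then have [measurable]: "cheb_U (Suc k) \<in> borel_measurable borel" "cheb_U k \<in> borel_measurable borel"
    by auto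
  have "(\<lambda>c. 2 * c * cheb_U (Suc k) c - cheb_U k c) \<in> borel_measurable borel" by measurable
  then show ?case by (simp add: cheb_U.simps(3)[abs_def])
qed (simp_all add: cheb_U.simps[abs_def])

section \<open>Local Euler factors and their majorant\<close>

lemma one_minus_2cos_pos:
  fixes r :: real
  assumes "0 \<le> r" "r < 1"
  shows "0 < 1 - 2 * cos x * r + r\<^sup>2"
proof -
  have "0 < (1 - r)\<^sup>2" using assms by simp
  also have "\<dots> \<le> 1 - 2 * cos x * r + r\<^sup>2"
    using mult_right_mono[OF cos_le_one[of x] assms(1)] by (simp add: power2_eq_square algebra_simps)
  finally show ?thesis .
qed

text \<open>The boundary terms vanish because a linear bound on the polynomials loses against
  \<open>r ^ K\<close>. At \<open>r = 1 / p\<close> the limit is the Euler factor at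
  \<open>p\<close>.\<close>

lemma sum_cheb_U_tendsto:
  fixes r :: real
  assumes "0 \<le> r" "r < 1"
  shows "(\<lambda>K. \<Sum>k\<le>K. cheb_U k (cos x) * r ^ k) \<longlonglongrightarrow> 1 / (1 - 2 * cos x * r + r\<^sup>2)"
proof -
  have lim0: "(\<lambda>K. real K * r ^ K) \<longlonglongrightarrow> 0" "(\<lambda>K. r ^ K) \<longlonglongrightarrow> 0"
    using assms by (auto intro!: LIMSEQ_realpow_zero powser_times_n_limit_0)
  have bnd: "(\<lambda>K. cheb_U K (cos x) * r ^ K) \<longlonglongrightarrow> 0"
  proof (rule Lim_null_comparison)
    have "norm (cheb_U K (cos x) * r ^ K) \<le> real K * r ^ K + r ^ K" for K
      using mult_right_mono[OF abs_cheb_U_cos_le[of K x], of "r ^ K"] assms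
      by (simp add: abs_mult distrib_right)
    then show "\<forall>\<^sub>F K in sequentially. norm (cheb_U K (cos x) * r ^ K) \<le> real K * r ^ K + r ^ K"
      by (intro always_eventually allI)
    show "(\<lambda>K. real K * r ^ K + r ^ K) \<longlonglongrightarrow> 0" using tendsto_add[OF lim0] by simp
  qed
  have "(\<lambda>K. 1 - cheb_U (Suc K) (cos x) * r ^ Suc K + r\<^sup>2 * (cheb_U K (cos x) * r ^ K))
      \<longlonglongrightarrow> 1 - 0 + r\<^sup>2 * 0"
    by (intro tendsto_intros bnd LIMSEQ_Suc[OF bnd])
  then have "(\<lambda>K. (1 - cheb_U (Suc K) (cos x) * r ^ Suc K
      + r\<^sup>2 * (cheb_U K (cos x) * r ^ K)) / (1 - 2 * cos x * r + r\<^sup>2))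
      \<longlonglongrightarrow> (1 - 0 + r\<^sup>2 * 0) / (1 - 2 * cos x * r + r\<^sup>2)"
    using one_minus_2cos_pos[OF assms, of x] by (intro tendsto_divide) auto
  moreover have "(1 - cheb_U (Suc K) (cos x) * r ^ Suc K
      + r\<^sup>2 * (cheb_U K (cos x) * r ^ K)) / (1 - 2 * cos x * r + r\<^sup>2)
      = (\<Sum>k\<le>K. cheb_U k (cos x) * r ^ k)" for K
    using one_minus_2cos_pos[OF assms, of x] sum_cheb_U_geometric[of "cos x" r K]
    by (simp add: field_simps power_add power2_eq_square)
  ultimately show ?thesis by simp
qed

text \<open>Truncation of the power series of \<open>1 / (1 - r)\<^sup>2\<close>, which majorises
  the generating function since the polynomials are at most \<open>k + 1\<close> at cosines.\<close>

lemma sum_Suc_power_le: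
  fixes r :: real
  assumes "0 \<le> r" "r < 1"
  shows "(\<Sum>k\<le>K. (real k + 1) * r ^ k) \<le> 1 / (1 - r)\<^sup>2"
proof -
  have "(\<Sum>k\<le>K. (real k + 1) * r ^ k) * (1 - r)\<^sup>2 = 1 - r ^ Suc K * (1 + (real K + 1) * (1 - r))"
    by (induction K) (simp_all add: algebra_simps power2_eq_square)
  also have "\<dots> \<le> 1" using assms by simp
  finally show ?thesis using assms by (simp add: field_simps)
qed

section \<open>Sums of multiplicative functions over friable numbers\<close>

text \<open>Bounding the exponents by \<open>K\<close> keeps the set finite for finite sets of
  primes, so that the Euler product is an exact finite identity; \<open>K\<close> is sent to
  infinity only in \<open>friable_sum_lower_bound\<close>.\<close>

definition friable :: "nat set \<Rightarrow> nat \<Rightarrow> nat set" where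
  "friable P K = {n. n > 0 \<and> prime_factors n \<subseteq> P \<and> (\<forall>p\<in>P. multiplicity p n \<le> K)}"

lemma friable_empty [simp]: "friable {} K = {1}"
  by (auto simp: friable_def prime_factorization_empty_iff)

lemma prime_factors_prime_power_mult:
  fixes p n :: nat
  assumes "prime p" "n > 0"
  shows "prime_factors (p ^ k * n) = (if k = 0 then {} else {p}) \<union> prime_factors n"
  using assms by (auto simp: prime_factorization_mult prime_factorization_prime_power)

lemma multiplicity_prime_power_mult:
  fixes p q n :: nat
  assumes "prime p" "prime q" "n > 0"
  shows "multiplicity q (p ^ k * n) = (if q = p then k else 0) + multiplicity q n"
  using assms
  by (auto simp: prime_elem_multiplicity_mult_distrib prime_elem_multiplicity_power_distrib
        prime_multiplicity_other)

lemma prime_power_decompose: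
  fixes p n :: nat
  assumes "prime p" "n > 0"
  obtains n' where "n = p ^ multiplicity p n * n'" "n' > 0" "\<not> p dvd n'"
proof -
  obtain n' where "n = p ^ multiplicity p n * n'" "\<not> p dvd n'"
    using assms by (metis multiplicity_decompose' not_prime_unit not_gr_zero)
  moreover from this have "n' > 0" by (auto intro: Nat.gr0I)
  ultimately show thesis using that by blast
qed

text \<open>The exponent is recovered from the product as the multiplicity of
  \<open>p\<close>.\<close>

lemma inj_prime_power_mult:
  fixes p :: nat
  assumes "prime p" "\<And>n. n \<in> S \<Longrightarrow> n > 0 \<and> \<not> p dvd n"
  shows "inj_on (\<lambda>(k, n). p ^ k * n) (UNIV \<times> S)"
proof (rule inj_onI, clarsimp)
  fix k n k' n' assume *: "n \<in> S" "n' \<in> S" "p ^ k * n = p ^ k' * n'"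
  have "multiplicity p (p ^ k * n) = k" if "n \<in> S" for k n
    using that assms by (simp add: multiplicity_prime_power_mult not_dvd_imp_multiplicity_0)
  from this[OF *(1)] this[OF *(2)] *(3) have "k = k'" by metis
  with * assms show "k = k' \<and> n = n'" by (auto simp: prime_gt_0_nat)
qed

lemma prime_factors_notin_dvd:
  fixes p n :: nat
  assumes "prime p" "n > 0" "prime_factors n \<subseteq> P" "p \<notin> P"
  shows "\<not> p dvd n"
  using assms by (auto simp: prime_factors_dvd)

lemma friable_insert:
  assumes "prime p" "p \<notin> P" "\<And>q. q \<in> P \<Longrightarrow> prime q"
  shows "bij_betw (\<lambda>(k, n). p ^ k * n) ({..K} \<times> friable P K) (friable (insert p P) K)"
  unfolding bij_betw_def
proof (intro conjI set_eqI iffI)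
  have "n > 0 \<and> \<not> p dvd n" if "n \<in> friable P K" for n
    using that assms(1,2) prime_factors_notin_dvd[of p n P] unfolding friable_def by blast
  then show "inj_on (\<lambda>(k, n). p ^ k * n) ({..K} \<times> friable P K)"
    by (intro inj_on_subset[OF inj_prime_power_mult[OF assms(1), of "friable P K"]]) auto
next
  fix m assume "m \<in> (\<lambda>(k, n). p ^ k * n) ` ({..K} \<times> friable P K)"
  then obtain k n where kn: "m = p ^ k * n" "k \<le> K" "n \<in> friable P K" by auto
  then have "n > 0" "prime_factors n \<subseteq> P" by (auto simp: friable_def)
  then have "multiplicity p n = 0"
    using assms(1,2) by (intro not_dvd_imp_multiplicity_0 prime_factors_notin_dvd[of p n P])
  then show "m \<in> friable (insert p P) K"
    using kn assms
    by (auto simp: friable_def prime_factors_prime_power_mult multiplicity_prime_power_mult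
          prime_gt_0_nat split: if_splits)
next
  fix m assume m: "m \<in> friable (insert p P) K"
  then have "m > 0" by (simp add: friable_def)
  then obtain n where n: "m = p ^ multiplicity p m * n" "n > 0" "\<not> p dvd n"
    using prime_power_decompose[OF assms(1)] by blast
  have "prime_factors n \<subseteq> prime_factors m"
    using n(2) assms(1) by (subst n(1), subst prime_factors_prime_power_mult) auto
  moreover have "p \<notin> prime_factors n" using n by auto
  moreover have "multiplicity q n \<le> multiplicity q m" if "q \<in> P" for q
    using n(2) assms(1) assms(3)[OF that] by (subst n(1), subst multiplicity_prime_power_mult) auto
  moreover have "multiplicity q m \<le> K" if "q \<in> P" for q
    using m that by (simp add: friable_def)
  ultimately have "n \<in> friable P K"
    using m n(2) unfolding friable_def by (blast intro: order_trans)
  moreover have "multiplicity p m \<le> K" using m by (simp add: friable_def)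
  ultimately show "m \<in> (\<lambda>(k, n). p ^ k * n) ` ({..K} \<times> friable P K)"
    by (intro image_eqI[of _ _ "(multiplicity p m, n)"]) (use n in auto)
qed

lemma finite_friable: "finite P \<Longrightarrow> (\<And>q. q \<in> P \<Longrightarrow> prime q) \<Longrightarrow> finite (friable P K)"
proof (induction P rule: finite_induct)
  case (insert p P)
  then show ?case using bij_betw_finite[OF friable_insert[of p P K]] by auto
qed simp

lemma multiplicative_prime_power_mult:
  assumes "multiplicative f" "prime p" "n > 0" "\<not> p dvd n"
  shows "f (p ^ k * n) = f (p ^ k) * f n"
  using assms unfolding multiplicative_def
  by (metis prime_imp_coprime_nat coprime_power_left_iff prime_gt_0_nat zero_less_power)

text \<open>Finite Euler product, one prime at a time: \<open>friable_insert\<close> splits off the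
  exact power of the new prime and multiplicativity factors the sum.\<close>

lemma sum_friable_eq_prod:
  assumes "multiplicative f" "finite P" "\<And>q. q \<in> P \<Longrightarrow> prime q"
  shows "(\<Sum>n\<in>friable P K. f n) = (\<Prod>p\<in>P. \<Sum>k\<le>K. f (p ^ k))"
  using assms(2,3)
proof (induction P rule: finite_induct)
  case empty
  then show ?case using assms(1) by (simp add: multiplicative_def)
next
  case (insert p P)
  have p: "prime p" using insert by simp
  have "(\<Sum>n\<in>friable (insert p P) K. f n) = (\<Sum>(k, n)\<in>{..K} \<times> friable P K. f (p ^ k * n))"
    using insert by (subst sum.reindex_bij_betw[OF friable_insert, symmetric]) (auto simp: case_prod_unfold)
  also have "\<dots> = (\<Sum>(k, n)\<in>{..K} \<times> friable P K. f (p ^ k) * f n)"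
  proof (intro sum.cong refl, clarsimp)
    fix k n assume "n \<in> friable P K"
    then show "f (p ^ k * n) = f (p ^ k) * f n"
      using insert p
      by (intro multiplicative_prime_power_mult[OF assms(1)] prime_factors_notin_dvd[of p n P])
         (auto simp: friable_def)
  qed
  also have "\<dots> = (\<Sum>k\<le>K. f (p ^ k)) * (\<Sum>n\<in>friable P K. f n)"
    by (simp add: sum_product sum.cartesian_product)
  finally show ?case using insert by simp
qed

text \<open>An exponent is smaller than the corresponding power of \<open>2\<close>, hence smaller
  than \<open>n\<close>.\<close>

lemma subset_friable:
  assumes "N \<le> K"
  shows "{n\<in>{1..N}. prime_factors n \<subseteq> P} \<subseteq> friable P K"
proof
  fix n assume n: "n \<in> {n\<in>{1..N}. prime_factors n \<subseteq> P}"
  have "multiplicity p n \<le> K" for p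
  proof (cases "p \<ge> 2")
    case True
    have "multiplicity p n < 2 ^ multiplicity p n" by (rule less_exp)
    also have "\<dots> \<le> p ^ multiplicity p n" using True by (intro power_mono) auto
    also have "\<dots> \<le> n" using n by (intro dvd_imp_le multiplicity_dvd) auto
    finally show ?thesis using n assms by auto
  next
    case False
    \<comment> \<open>At these two values \<open>multiplicity\<close> is \<open>0\<close> by
      convention.\<close>
    then have "p = 0 \<or> p = 1" by auto
    then show ?thesis by (auto simp: multiplicity_unit_left)
  qed
  then show "n \<in> friable P K" using n by (auto simp: friable_def)
qed

section \<open>Normalised Hecke multiplicative functions\<close>

text \<open>The normalised function as an explicit expression in the angles at the prime factors of
  \<open>n\<close>, free of \<open>m\<close>; measurability and dependence on finitely many angles
  can be read off.\<close>

definition hecke_lambda :: "(nat \<Rightarrow> real) \<Rightarrow> nat \<Rightarrow> real" where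
  "hecke_lambda t n = (\<Prod>p\<in>prime_factors n. cheb_U (multiplicity p n) (cos (t p)))"

lemma hecke_lambda_prime_power:
  "prime p \<Longrightarrow> hecke_lambda t (p ^ k) = cheb_U k (cos (t p))"
  by (cases "k = 0") (simp_all add: hecke_lambda_def prime_factorization_prime_power)

lemma hecke_lambda_prime_power_mult:
  assumes "prime p" "n > 0" "\<not> p dvd n"
  shows "hecke_lambda t (p ^ k * n) = cheb_U k (cos (t p)) * hecke_lambda t n"
proof (cases "k = 0")
  case False
  have "hecke_lambda t (p ^ k * n)
      = (\<Prod>q\<in>insert p (prime_factors n). cheb_U (multiplicity q (p ^ k * n)) (cos (t q)))"
    using assms False unfolding hecke_lambda_def by (subst prime_factors_prime_power_mult) auto
  also have "\<dots> = cheb_U (multiplicity p (p ^ k * n)) (cos (t p)) *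
      (\<Prod>q\<in>prime_factors n. cheb_U (multiplicity q (p ^ k * n)) (cos (t q)))"
    using assms by (intro prod.insert) auto
  also have "(\<Prod>q\<in>prime_factors n. cheb_U (multiplicity q (p ^ k * n)) (cos (t q))) = hecke_lambda t n"
    unfolding hecke_lambda_def
  proof (intro prod.cong refl)
    fix q assume "q \<in> prime_factors n"
    then have "prime q" "q \<noteq> p" using assms by auto
    then show "cheb_U (multiplicity q (p ^ k * n)) (cos (t q)) = cheb_U (multiplicity q n) (cos (t q))"
      using assms by (simp add: multiplicity_prime_power_mult)
  qed
  also have "multiplicity p (p ^ k * n) = k"
    using assms by (simp add: multiplicity_prime_power_mult not_dvd_imp_multiplicity_0)
  finally show ?thesis .
qed simp

text \<open>Strong induction on the first factor, removing the full power of one of its primes,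
  which by coprimality does not divide the second factor.\<close>

lemma multiplicative_hecke_lambda: "multiplicative (hecke_lambda t)"
proof -
  have "a > 0 \<Longrightarrow> b > 0 \<Longrightarrow> coprime a b \<Longrightarrow>
    hecke_lambda t (a * b) = hecke_lambda t a * hecke_lambda t b" for a b :: nat
  proof (induction a rule: less_induct)
    case (less a)
    show ?case
    proof (cases "a = 1")
      case False
      then obtain p where p: "prime p" "p dvd a" using prime_factor_nat by blast
      define k where "k = multiplicity p a"
      obtain a' where a': "a = p ^ k * a'" "a' > 0" "\<not> p dvd a'"
        using prime_power_decompose[OF p(1) less.prems(1)] unfolding k_def by blast
      have "k > 0" using p a' by (auto intro: Nat.gr0I)
      then have "1 < p ^ k" using prime_gt_1_nat[OF p(1)] by (rule one_less_power[rotated])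
      then have "a' < a" using a'(1,2) by simp
      moreover have cop: "coprime a' b" "\<not> p dvd b"
        using less.prems(3) p a' by (auto simp: prime_nat_iff coprime_absorb_left dest: coprime_common_divisor)
      ultimately have IH: "hecke_lambda t (a' * b) = hecke_lambda t a' * hecke_lambda t b"
        using less a' by blast
      have "\<not> p dvd a' * b" using p cop a' by (simp add: prime_dvd_mult_iff)
      then show ?thesis
        using p a' less.prems(2) IH
        by (simp add: mult.assoc hecke_lambda_prime_power_mult)
    qed (simp add: hecke_lambda_def)
  qed
  then show ?thesis by (simp add: multiplicative_def hecke_lambda_def)
qed

lemma multiplicative_eqI:
  assumes "multiplicative f" "multiplicative g"
    and "\<And>p k. prime p \<Longrightarrow> f (p ^ k) = g (p ^ k)"
  shows "n > 0 \<Longrightarrow> f n = g n"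
proof (induction n rule: less_induct)
  case (less a)
  show ?case
  proof (cases "a = 1")
    case True
    then show ?thesis using assms by (simp add: multiplicative_def)
  next
    case False
    then obtain p where p: "prime p" "p dvd a" using prime_factor_nat by blast
    define k where "k = multiplicity p a"
    obtain a' where a': "a = p ^ k * a'" "a' > 0" "\<not> p dvd a'"
      using prime_power_decompose[OF p(1) less.prems(1)] unfolding k_def by blast
    have "k > 0" using p a' by (auto intro: Nat.gr0I)
    then have "1 < p ^ k" using prime_gt_1_nat[OF p(1)] by (rule one_less_power[rotated])
    then have "a' < a" using a'(1,2) by simp
    then have "f a' = g a'" using less a' by blast
    then show ?thesis
      using multiplicative_prime_power_mult[OF assms(1) p(1) a'(2,3), of k]
        multiplicative_prime_power_mult[OF assms(2) p(1) a'(2,3), of k] assms(3)[OF p(1)] a'(1)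
      by simp
  qed
qed

lemma hecke_function_eq:
  assumes "hecke_function m t f" "n > 0"
  shows "f n = real n powr (m / 2) * hecke_lambda t n"
proof (rule multiplicative_eqI[OF _ _ _ assms(2)])
  show "multiplicative f" using assms(1) by (simp add: hecke_function_def)
  show "multiplicative (\<lambda>n. real n powr (m / 2) * hecke_lambda t n)"
    using multiplicative_hecke_lambda[of t] by (auto simp: multiplicative_def powr_mult)
next
  fix p k :: nat assume p: "prime p"
  have f1: "f 1 = 1" using assms(1) by (simp add: hecke_function_def multiplicative_def)
  have fp: "f p = 2 * real p powr (m / 2) * cos (t p)"
    using assms(1) p by (simp add: hecke_function_def)
  have rec: "f (p ^ Suc (Suc k)) = f p * f (p ^ Suc k) - real p ^ m * f (p ^ k)" for k
  proof -
    have "\<forall>p k. prime p \<and> k \<ge> 1 \<longrightarrow>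
        f (p ^ (k + 1)) = f p * f (p ^ k) - real p ^ m * f (p ^ (k - 1))"
      using assms(1) unfolding hecke_function_def by blast
    from this[rule_format, of p "Suc k"] p show ?thesis by simp
  qed
  \<comment> \<open>Splitting \<open>p ^ m\<close> into two equal factors lets both terms of the
    recurrence carry the same power of \<open>p powr (m / 2)\<close>.\<close>
  have sq: "real p ^ m = real p powr (m / 2) * real p powr (m / 2)"
    using prime_gt_0_nat[OF p] by (simp add: powr_realpow flip: powr_add)
  have "f (p ^ k) = (real p powr (m / 2)) ^ k * cheb_U k (cos (t p))"
  proof (induction k "cos (t p)" rule: cheb_U.induct)
    case (3 k)
    then show ?case by (simp only: rec fp sq cheb_U.simps) (simp add: algebra_simps)
  qed (use f1 fp in simp_all)
  also have "(real p powr (m / 2)) ^ k = real (p ^ k) powr (m / 2)"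
    using prime_gt_0_nat[OF p] by (simp add: powr_power powr_powr mult.commute flip: powr_realpow)
  finally show "f (p ^ k) = real (p ^ k) powr (m / 2) * hecke_lambda t (p ^ k)"
    using p by (simp add: hecke_lambda_prime_power)
qed

text \<open>Keeping the cutoff \<open>N\<close> fixed and letting \<open>P\<close> grow through the
  primes gives the martingale; the set of all primes up to \<open>N\<close> gives the full
  sum.\<close>

definition friable_sum :: "(nat \<Rightarrow> real) \<Rightarrow> nat set \<Rightarrow> nat \<Rightarrow> real" where
  "friable_sum t P N = (\<Sum>n | n \<in> {1..N} \<and> prime_factors n \<subseteq> P. hecke_lambda t n / real n)"

text \<open>Since \<open>(m + 2) / 2 = m / 2 + 1\<close>, the normalisation leaves the weight
  \<open>1 / n\<close>, and \<open>m\<close> disappears from the problem.\<close>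

lemma partial_sum_eq_friable_sum:
  assumes "hecke_function m t f"
  shows "partial_sum m f x = friable_sum t (primes_upto (nat \<lfloor>x\<rfloor>)) (nat \<lfloor>x\<rfloor>)"
proof -
  have "partial_sum m f x = (\<Sum>n\<in>{1..nat \<lfloor>x\<rfloor>}. hecke_lambda t n / real n)"
    unfolding partial_sum_def
  proof (intro sum.cong refl)
    fix n assume "n \<in> {1..nat \<lfloor>x\<rfloor>}"
    then have n: "n > 0" by simp
    have "real n powr ((real m + 2) / 2) = real n powr (m / 2) * real n"
      using n by (simp add: add_divide_distrib powr_add)
    then show "f n / real n powr ((real m + 2) / 2) = hecke_lambda t n / real n"
      using n by (simp add: hecke_function_eq[OF assms n])
  qed
  also have "{1..nat \<lfloor>x\<rfloor>} = {n. n \<in> {1..nat \<lfloor>x\<rfloor>} \<and> prime_factors n \<subseteq> primes_upto (nat \<lfloor>x\<rfloor>)}"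
    by (auto simp: primes_upto_def prime_factors_dvd dest!: dvd_imp_le)
  finally show ?thesis by (simp only: friable_sum_def)
qed

text \<open>Each \<open>n\<close> is split by its exact power of \<open>p\<close>, so the new angle
  enters only through the Chebyshev factors. Stopping at \<open>k = N\<close> loses nothing, because
  \<open>N div p ^ k\<close> is already \<open>0\<close> once \<open>p ^ k > N\<close>.\<close>

lemma friable_sum_insert:
  assumes "prime p" "p \<notin> P"
  shows "friable_sum t (insert p P) N =
    (\<Sum>k\<le>N. cheb_U k (cos (t p)) / real p ^ k * friable_sum t P (N div p ^ k))"
proof -
  let ?A = "\<lambda>P N. {n. n \<in> {1..N} \<and> prime_factors n \<subseteq> P}"
  let ?h = "\<lambda>(k, n). p ^ k * n"
  let ?S = "Sigma {..N} (\<lambda>k. ?A P (N div p ^ k))"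
  have p0: "p > 0" "p ^ k > 0" for k using assms(1) prime_gt_0_nat by auto
  have nd: "n > 0 \<and> \<not> p dvd n" if "n \<in> ?A P M" for n M
    using that assms prime_factors_notin_dvd[of p n P] by auto
  have "inj_on ?h ?S"
    by (rule inj_on_subset[OF inj_prime_power_mult[OF assms(1), of "?A P N"]])
       (use nd[of _ N] in \<open>auto intro: order_trans[OF _ div_le_dividend]\<close>)
  moreover have "?h ` ?S = ?A (insert p P) N"
  proof (intro equalityI subsetI)
    fix m assume "m \<in> ?h ` ?S"
    then obtain k n where kn: "m = p ^ k * n" "n \<in> ?A P (N div p ^ k)" by auto
    then have "p ^ k * n \<le> N"
      using p0(2)[of k] by (simp add: less_eq_div_iff_mult_less_eq mult.commute)
    then show "m \<in> ?A (insert p P) N"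
      using kn p0(2)[of k] assms(1) prime_factors_prime_power_mult[of p n k] by auto
  next
    fix m assume m: "m \<in> ?A (insert p P) N"
    then obtain n where n: "m = p ^ multiplicity p m * n" "n > 0" "\<not> p dvd n"
      using prime_power_decompose[OF assms(1), of m] by auto
    let ?k = "multiplicity p m"
    have "prime_factors n \<subseteq> prime_factors m"
      using n(2) assms(1) by (subst n(1), subst prime_factors_prime_power_mult) auto
    then have "prime_factors n \<subseteq> P" using m n by auto
    moreover have "n \<le> N div p ^ ?k"
      using m n(1) p0(2)[of ?k] by (simp add: less_eq_div_iff_mult_less_eq mult.commute)
    moreover have "?k \<le> N" using subset_friable[of N N "insert p P"] m by (auto simp: friable_def)
    ultimately have "(?k, n) \<in> ?S" using n(2) by auto
    then show "m \<in> ?h ` ?S" using n(1) by (intro image_eqI[of _ _ "(?k, n)"]) simp_all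
  qed
  ultimately have "bij_betw ?h ?S (?A (insert p P) N)" by (rule bij_betw_imageI)
  then have "friable_sum t (insert p P) N = (\<Sum>x\<in>?S. hecke_lambda t (?h x) / real (?h x))"
    unfolding friable_sum_def by (rule sum.reindex_bij_betw[symmetric])
  also have "\<dots> = (\<Sum>(k, n)\<in>?S. hecke_lambda t (p ^ k * n) / real (p ^ k * n))"
    by (simp add: case_prod_unfold)
  also have "\<dots> = (\<Sum>(k, n)\<in>?S. cheb_U k (cos (t p)) / real p ^ k * (hecke_lambda t n / real n))"
  proof (intro sum.cong refl)
    fix x assume "x \<in> ?S"
    then obtain k n where x: "x = (k, n)" "n \<in> ?A P (N div p ^ k)" by auto
    show "(case x of (k, n) \<Rightarrow> hecke_lambda t (p ^ k * n) / real (p ^ k * n)) =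
      (case x of (k, n) \<Rightarrow> cheb_U k (cos (t p)) / real p ^ k * (hecke_lambda t n / real n))"
      using nd[OF x(2)] by (simp add: x(1) hecke_lambda_prime_power_mult[OF assms(1)])
  qed
  also have "\<dots> = (\<Sum>k\<le>N. \<Sum>n\<in>?A P (N div p ^ k). cheb_U k (cos (t p)) / real p ^ k
      * (hecke_lambda t n / real n))"
    by (subst sum.Sigma) auto
  finally show ?thesis by (simp only: friable_sum_def sum_distrib_left)
qed

section \<open>Bounds for friable sums that hold for all angles\<close>

lemma sum_friable_abs_hecke_lambda_le:
  assumes "finite P" "\<And>q. q \<in> P \<Longrightarrow> prime q" "\<sigma> > 0"
  shows "(\<Sum>n\<in>friable P K. \<bar>hecke_lambda t n\<bar> * real n powr - \<sigma>)
    \<le> (\<Prod>p\<in>P. 1 / (1 - real p powr - \<sigma>)\<^sup>2)"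
proof -
  have "multiplicative (\<lambda>n. \<bar>hecke_lambda t n\<bar> * real n powr - \<sigma>)"
    using multiplicative_hecke_lambda[of t] by (auto simp: multiplicative_def powr_mult abs_mult)
  then have "(\<Sum>n\<in>friable P K. \<bar>hecke_lambda t n\<bar> * real n powr - \<sigma>)
      = (\<Prod>p\<in>P. \<Sum>k\<le>K. \<bar>hecke_lambda t (p ^ k)\<bar> * real (p ^ k) powr - \<sigma>)"
    using assms by (intro sum_friable_eq_prod)
  also have "\<dots> \<le> (\<Prod>p\<in>P. 1 / (1 - real p powr - \<sigma>)\<^sup>2)"
  proof (intro prod_mono conjI sum_nonneg)
    fix p assume "p \<in> P"
    then have p: "prime p" using assms by simp
    then have p1: "real p > 1" using prime_gt_1_nat by simp
    have r: "0 \<le> real p powr - \<sigma>" "real p powr - \<sigma> < 1"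
      using p1 assms(3) by (simp_all add: powr_less_one)
    have "(\<Sum>k\<le>K. \<bar>hecke_lambda t (p ^ k)\<bar> * real (p ^ k) powr - \<sigma>)
        \<le> (\<Sum>k\<le>K. (real k + 1) * (real p powr - \<sigma>) ^ k)"
    proof (intro sum_mono mult_mono)
      fix k
      show "\<bar>hecke_lambda t (p ^ k)\<bar> \<le> real k + 1"
        using p by (simp add: hecke_lambda_prime_power abs_cheb_U_cos_le)
      show "real (p ^ k) powr - \<sigma> \<le> (real p powr - \<sigma>) ^ k"
        using p1 by (simp add: powr_power powr_powr mult.commute flip: powr_realpow)
    qed auto
    also have "\<dots> \<le> 1 / (1 - real p powr - \<sigma>)\<^sup>2" using r by (rule sum_Suc_power_le)
    finally show "(\<Sum>k\<le>K. \<bar>hecke_lambda t (p ^ k)\<bar> * real (p ^ k) powr - \<sigma>) \<le> \<dots>" .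
  qed auto
  finally show ?thesis .
qed

text \<open>The case \<open>\<sigma> = 1\<close> of the preceding bound. Uniformity in
  \<open>N\<close> allows it to be applied to every \<open>N div p ^ k\<close>.\<close>

lemma abs_friable_sum_le:
  assumes "finite P" "\<And>q. q \<in> P \<Longrightarrow> prime q"
  shows "\<bar>friable_sum t P N\<bar> \<le> (\<Prod>p\<in>P. 1 / (1 - 1 / real p)\<^sup>2)"
proof -
  have "\<bar>friable_sum t P N\<bar> \<le> (\<Sum>n | n \<in> {1..N} \<and> prime_factors n \<subseteq> P. \<bar>hecke_lambda t n / real n\<bar>)"
    unfolding friable_sum_def by (rule sum_abs)
  also have "\<dots> = (\<Sum>n | n \<in> {1..N} \<and> prime_factors n \<subseteq> P. \<bar>hecke_lambda t n\<bar> * real n powr - 1)"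
    by (intro sum.cong refl) (auto simp: powr_minus divide_inverse abs_mult)
  also have "\<dots> \<le> (\<Sum>n\<in>friable P N. \<bar>hecke_lambda t n\<bar> * real n powr - 1)"
    using subset_friable[of N N P] by (intro sum_mono2 finite_friable assms) auto
  also have "\<dots> \<le> (\<Prod>p\<in>P. 1 / (1 - real p powr - 1)\<^sup>2)"
    by (intro sum_friable_abs_hecke_lambda_le assms) auto
  also have "\<dots> = (\<Prod>p\<in>P. 1 / (1 - 1 / real p)\<^sup>2)"
    by (intro prod.cong refl) (simp add: powr_minus divide_inverse)
  finally show ?thesis .
qed

text \<open>This is the martingale difference at \<open>p\<close>: removing the term
  \<open>k = 0\<close> leaves Chebyshev factors of positive index, each multiplied by a sum over the
  earlier primes.\<close>

lemma friable_sum_insert_diff: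
  assumes "prime p" "p \<notin> P"
  shows "friable_sum t (insert p P) N - friable_sum t P N =
    (\<Sum>k=1..N. cheb_U k (cos (t p)) / real p ^ k * friable_sum t P (N div p ^ k))"
proof -
  have "{..N} = insert 0 {1..N}" by auto
  then show ?thesis unfolding friable_sum_insert[OF assms] by simp
qed

lemma abs_friable_sum_insert_diff_le:
  assumes "prime p" "p \<notin> P" "finite P" "\<And>q. q \<in> P \<Longrightarrow> prime q"
  shows "\<bar>friable_sum t (insert p P) N - friable_sum t P N\<bar>
    \<le> 8 / real p * (\<Prod>q\<in>P. 1 / (1 - 1 / real q)\<^sup>2)"
proof -
  define B where "B = (\<Prod>q\<in>P. 1 / (1 - 1 / real q)\<^sup>2)"
  define r where "r = 1 / real p"
  have B: "B \<ge> 0" unfolding B_def by (intro prod_nonneg) auto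
  have r: "0 \<le> r" "r \<le> 1 / 2" using prime_ge_2_nat[OF assms(1)] by (auto simp: r_def field_simps)
  have "\<bar>friable_sum t (insert p P) N - friable_sum t P N\<bar>
      \<le> (\<Sum>k=1..N. \<bar>cheb_U k (cos (t p)) / real p ^ k * friable_sum t P (N div p ^ k)\<bar>)"
    unfolding friable_sum_insert_diff[OF assms(1,2)] by (rule sum_abs)
  also have "\<dots> \<le> (\<Sum>k=1..N. (real k + 1) * r ^ k * B)"
  proof (intro sum_mono)
    fix k
    have "\<bar>cheb_U k (cos (t p))\<bar> * r ^ k * \<bar>friable_sum t P (N div p ^ k)\<bar> \<le> (real k + 1) * r ^ k * B"
      using abs_friable_sum_le[OF assms(3,4), of t "N div p ^ k"] abs_cheb_U_cos_le[of k "t p"] B r(1)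
      by (intro mult_mono) (auto simp: B_def)
    then show "\<bar>cheb_U k (cos (t p)) / real p ^ k * friable_sum t P (N div p ^ k)\<bar>
        \<le> (real k + 1) * r ^ k * B"
      by (simp add: abs_mult r_def power_divide)
  qed
  also have "\<dots> = (\<Sum>k=1..N. (real k + 1) * r ^ k) * B" by (simp add: sum_distrib_right)
  also have "\<dots> \<le> 8 * r * B"
  proof (intro mult_right_mono B)
    \<comment> \<open>Shifting the index with \<open>k + 2 \<le> 2 * (k + 1)\<close> extracts one
      factor \<open>r\<close>; then \<open>r \<le> 1 / 2\<close> bounds the remaining series by
      \<open>4\<close>, whence the constant \<open>8\<close>.\<close>
    have "(\<Sum>k=1..N. (real k + 1) * r ^ k) \<le> 2 * r * (\<Sum>k<N. (real k + 1) * r ^ k)"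
    proof (induction N)
      case (Suc N)
      have "r ^ Suc N * (real (Suc N) + 1) \<le> r ^ Suc N * (2 * (real N + 1))"
        using r by (intro mult_left_mono) auto
      with Suc show ?case by (simp add: algebra_simps)
    qed simp
    also have "\<dots> \<le> 2 * r * (\<Sum>k\<le>N. (real k + 1) * r ^ k)"
      using r by (intro mult_left_mono sum_mono2) auto
    also have "\<dots> \<le> 2 * r * (1 / (1 - r)\<^sup>2)"
      using r by (intro mult_left_mono sum_Suc_power_le) auto
    also have "\<dots> \<le> 2 * r * (1 / (1 / 2)\<^sup>2)"
      using r by (intro mult_left_mono divide_left_mono power_mono) auto
    finally show "(\<Sum>k=1..N. (real k + 1) * r ^ k) \<le> 8 * r" by (simp add: power2_eq_square)
  qed
  finally show ?thesis by (simp add: B_def r_def)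
qed

text \<open>Euler product minus tail. Every factor is smallest when the cosine is \<open>-1\<close>,
  which gives the main term; Rankin's trick trades \<open>z powr - \<delta>\<close> for a shift of
  the exponent in the tail. A real \<open>z\<close> is allowed so that \<open>x\<close> itself can
  be used with \<open>N\<close> its floor.\<close>

lemma friable_sum_lower_bound:
  fixes z \<delta> :: real
  assumes P: "finite P" "\<And>q. q \<in> P \<Longrightarrow> prime q"
    and "0 < \<delta>" "\<delta> < 1" "0 < z" "z \<le> real N + 1"
  shows "friable_sum t P N \<ge> (\<Prod>p\<in>P. 1 / (1 + 1 / real p)\<^sup>2)
    - z powr - \<delta> * (\<Prod>p\<in>P. 1 / (1 - real p powr (\<delta> - 1))\<^sup>2)"
proof -
  let ?A = "{n\<in>{1..N}. prime_factors n \<subseteq> P}"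
  let ?E = "\<Prod>p\<in>P. 1 / (1 - real p powr (\<delta> - 1))\<^sup>2"
  have mult: "multiplicative (\<lambda>n. hecke_lambda t n / real n)"
    using multiplicative_hecke_lambda[of t] by (auto simp: multiplicative_def)
  have lower: "(\<Prod>p\<in>P. \<Sum>k\<le>K. cheb_U k (cos (t p)) * (1 / real p) ^ k) - z powr - \<delta> * ?E
      \<le> friable_sum t P N" if "K \<ge> N" for K
  proof -
    have sub: "?A \<subseteq> friable P K" using that by (rule subset_friable)
    have fin: "finite (friable P K)" by (intro finite_friable P)
    have "(\<Sum>n\<in>friable P K - ?A. hecke_lambda t n / real n)
        \<le> (\<Sum>n\<in>friable P K - ?A. z powr - \<delta> * (\<bar>hecke_lambda t n\<bar> * real n powr - (1 - \<delta>)))"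
    proof (rule sum_mono)
      fix n assume "n \<in> friable P K - ?A"
      then have n: "n > 0" "n > N" by (auto simp: friable_def)
      \<comment> \<open>An omitted \<open>n\<close> exceeds \<open>N\<close>, hence is at least
        \<open>N + 1\<close>.\<close>
      then have zn: "z \<le> real n" using assms(6) by linarith
      have "hecke_lambda t n / real n \<le> \<bar>hecke_lambda t n\<bar> * real n powr - 1"
        using n by (simp add: powr_minus divide_inverse mult_right_mono)
      also have "real n powr - 1 = real n powr - \<delta> * real n powr - (1 - \<delta>)"
        by (simp flip: powr_add)
      also have "\<bar>hecke_lambda t n\<bar> * (real n powr - \<delta> * real n powr - (1 - \<delta>))
          \<le> \<bar>hecke_lambda t n\<bar> * (z powr - \<delta> * real n powr - (1 - \<delta>))"
        using zn assms(3,5) by (intro mult_left_mono mult_right_mono powr_mono2') auto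
      finally show "hecke_lambda t n / real n
          \<le> z powr - \<delta> * (\<bar>hecke_lambda t n\<bar> * real n powr - (1 - \<delta>))" by (simp add: mult_ac)
    qed
    also have "\<dots> \<le> (\<Sum>n\<in>friable P K. z powr - \<delta> * (\<bar>hecke_lambda t n\<bar> * real n powr - (1 - \<delta>)))"
      using fin by (intro sum_mono2) auto
    also have "\<dots> = z powr - \<delta> * (\<Sum>n\<in>friable P K. \<bar>hecke_lambda t n\<bar> * real n powr - (1 - \<delta>))"
      by (simp add: sum_distrib_left)
    also have "\<dots> \<le> z powr - \<delta> * (\<Prod>p\<in>P. 1 / (1 - real p powr - (1 - \<delta>))\<^sup>2)"
      using assms(4) by (intro mult_left_mono sum_friable_abs_hecke_lambda_le P) auto
    finally have tail: "(\<Sum>n\<in>friable P K - ?A. hecke_lambda t n / real n) \<le> z powr - \<delta> * ?E" by simp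
    have "(\<Prod>p\<in>P. \<Sum>k\<le>K. cheb_U k (cos (t p)) * (1 / real p) ^ k)
        = (\<Prod>p\<in>P. \<Sum>k\<le>K. hecke_lambda t (p ^ k) / real (p ^ k))"
      using P(2) by (intro prod.cong sum.cong refl) (simp add: hecke_lambda_prime_power power_divide)
    also have "\<dots> = (\<Sum>n\<in>friable P K. hecke_lambda t n / real n)"
      by (rule sum_friable_eq_prod[OF mult P, symmetric])
    also have "\<dots> = (\<Sum>n\<in>friable P K - ?A. hecke_lambda t n / real n) + friable_sum t P N"
      using sum.subset_diff[OF sub fin] by (simp add: friable_sum_def)
    finally show ?thesis using tail by linarith
  qed
  have r: "0 \<le> 1 / real p" "1 / real p < 1" if "p \<in> P" for p
    using prime_gt_1_nat[OF P(2)[OF that]] by auto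
  \<comment> \<open>The tail bound does not depend on \<open>K\<close>, so only the truncated Euler
    product changes in the limit.\<close>
  have "(\<lambda>K. (\<Prod>p\<in>P. \<Sum>k\<le>K. cheb_U k (cos (t p)) * (1 / real p) ^ k) - z powr - \<delta> * ?E)
      \<longlonglongrightarrow> (\<Prod>p\<in>P. 1 / (1 - 2 * cos (t p) * (1 / real p) + (1 / real p)\<^sup>2)) - z powr - \<delta> * ?E"
    by (intro tendsto_intros sum_cheb_U_tendsto r)
  then have "(\<Prod>p\<in>P. 1 / (1 - 2 * cos (t p) * (1 / real p) + (1 / real p)\<^sup>2)) - z powr - \<delta> * ?E
      \<le> friable_sum t P N"
    by (rule LIMSEQ_le_const2) (use lower in blast)
  moreover have "(\<Prod>p\<in>P. 1 / (1 + 1 / real p)\<^sup>2)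
      \<le> (\<Prod>p\<in>P. 1 / (1 - 2 * cos (t p) * (1 / real p) + (1 / real p)\<^sup>2))"
  proof (intro prod_mono conjI)
    fix p assume p: "p \<in> P"
    have "1 - 2 * cos (t p) * (1 / real p) + (1 / real p)\<^sup>2 \<le> (1 + 1 / real p)\<^sup>2"
      using mult_right_mono[OF cos_ge_minus_one[of "t p"] r(1)[OF p]]
      by (simp add: power2_eq_square algebra_simps)
    then show "1 / (1 + 1 / real p)\<^sup>2 \<le> 1 / (1 - 2 * cos (t p) * (1 / real p) + (1 / real p)\<^sup>2)"
      using one_minus_2cos_pos[OF r[OF p], of "t p"] by (intro divide_left_mono mult_pos_pos) auto
  qed auto
  ultimately show ?thesis by linarith
qed

text \<open>The range up to \<open>3 / 4\<close> is chosen to contain \<open>1 / sqrt 2\<close>, the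
  largest value met in the Rankin product.\<close>

lemma inverse_square_one_minus_le_exp:
  fixes s :: real
  assumes "0 \<le> s" "s \<le> 3 / 4"
  shows "1 / (1 - s)\<^sup>2 \<le> exp (8 * s)"
proof -
  have "1 / (1 - s) = 1 + s / (1 - s)" using assms by (simp add: field_simps)
  also have "\<dots> \<le> 1 + 4 * s"
  proof -
    have "s / (1 - s) \<le> s / (1 / 4)" using assms by (intro divide_left_mono) auto
    then show ?thesis by simp
  qed
  also have "\<dots> \<le> exp (4 * s)" by (rule exp_ge_add_one_self)
  finally have "(1 / (1 - s))\<^sup>2 \<le> (exp (4 * s))\<^sup>2" using assms by (intro power_mono) auto
  then show ?thesis by (simp add: power_divide flip: exp_double)
qed

section \<open>The Sato--Tate law\<close>

text \<open>Half-lines \<open>{a<..}\<close> determine a finite measure on the reals, and their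
  probabilities come from the interval formula because the angles stay inside
  \<open>(0, pi)\<close>.\<close>

lemma (in prob_space) distr_sato_tate:
  assumes "sato_tate_family M \<theta>" "prime p"
  shows "distr M borel (\<theta> p)
    = density lborel (\<lambda>x. ennreal (indicator {0..pi} x * (2 / pi * (sin x)\<^sup>2)))"
proof (rule measure_eqI_lessThan)
  have rv [measurable]: "\<theta> p \<in> borel_measurable M"
    using assms by (auto simp: sato_tate_family_def indep_vars_def)
  interpret D: prob_space "distr M borel (\<theta> p)" by (rule prob_space_distr) measurable
  show "emeasure (distr M borel (\<theta> p)) {x<..} < \<infinity>" for x
    by (simp only: D.emeasure_eq_measure) simp
  have rng: "0 < \<theta> p \<omega>" "\<theta> p \<omega> < pi" if "\<omega> \<in> space M" for \<omega>
    using assms that by (auto simp: sato_tate_family_def)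
  fix a :: real
  let ?f = "\<lambda>x. 2 / pi * (sin x)\<^sup>2 :: real"
  have L: "emeasure (distr M borel (\<theta> p)) {a<..} = prob {\<omega> \<in> space M. a < \<theta> p \<omega>}"
    by (subst emeasure_distr) (auto simp: emeasure_eq_measure intro!: arg_cong[where f=prob])
  have R: "emeasure (density lborel (\<lambda>x. ennreal (indicator {0..pi} x * ?f x))) {a<..}
      = (\<integral>\<^sup>+x. ennreal (indicator {0..pi} x * ?f x) * indicator {a<..} x \<partial>lborel)"
    by (subst emeasure_density) auto
  show "emeasure (distr M borel (\<theta> p)) {a<..}
      = emeasure (density lborel (\<lambda>x. ennreal (indicator {0..pi} x * ?f x))) {a<..}"
  proof (cases "a < pi")
    case True
    \<comment> \<open>Negative \<open>a\<close> is moved to \<open>0\<close> to meet the range of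
      the interval formula.\<close>
    define b where "b = max a 0"
    have b: "0 \<le> b" "b < pi" using True by (auto simp: b_def)
    have "{\<omega> \<in> space M. a < \<theta> p \<omega>} = {\<omega> \<in> space M. b < \<theta> p \<omega> \<and> \<theta> p \<omega> < pi}"
      using rng by (auto simp: b_def)
    then have 1: "prob {\<omega> \<in> space M. a < \<theta> p \<omega>} = 2 / pi * integral {b..pi} (\<lambda>t. (sin t)\<^sup>2)"
      using assms b by (auto simp: sato_tate_family_def)
    have "(\<lambda>t. (sin t)\<^sup>2) integrable_on {b..pi}"
      by (intro integrable_continuous_real continuous_intros)
    then have "(?f has_integral 2 / pi * integral {b..pi} (\<lambda>t. (sin t)\<^sup>2)) {b..pi}"
      by (intro has_integral_mult_right integrable_integral)
    then have "(\<integral>\<^sup>+x. ennreal (?f x) * indicator {b..pi} x \<partial>lborel)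
        = 2 / pi * integral {b..pi} (\<lambda>t. (sin t)\<^sup>2)"
      by (rule nn_integral_has_integral_lebesgue'[rotated]) auto
    \<comment> \<open>The integrands can differ only at the left endpoint \<open>b\<close>, a null
      set.\<close>
    moreover have "(\<integral>\<^sup>+x. ennreal (indicator {0..pi} x * ?f x) * indicator {a<..} x \<partial>lborel)
        = (\<integral>\<^sup>+x. ennreal (?f x) * indicator {b..pi} x \<partial>lborel)"
      by (intro nn_integral_cong_AE AE_mp[OF AE_lborel_singleton[of b] AE_I2])
         (auto simp: b_def max_def split: split_indicator if_splits)
    ultimately show ?thesis using L R 1 by simp
  next
    case False
    then have "{\<omega> \<in> space M. a < \<theta> p \<omega>} = {}" using rng by force
    then have "prob {\<omega> \<in> space M. a < \<theta> p \<omega>} = 0" by (simp only: measure_empty)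
    moreover have "(\<integral>\<^sup>+x. ennreal (indicator {0..pi} x * ?f x) * indicator {a<..} x \<partial>lborel)
        = (\<integral>\<^sup>+(x::real). 0 \<partial>lborel)"
      using False by (intro nn_integral_cong) (auto split: split_indicator)
    ultimately show ?thesis using L R by simp
  qed
qed simp_all

text \<open>Orthogonality to the constant \<open>1\<close>: one factor \<open>sin x\<close> of the
  density turns the polynomial into \<open>sin ((k + 1) * x)\<close>, and the product formula leaves
  two cosines of nonzero integer frequency, whose integrals over \<open>[0, pi]\<close>
  vanish.\<close>

lemma (in prob_space) expectation_cheb_U_sato_tate:
  assumes "sato_tate_family M \<theta>" "prime p" "k \<ge> 1"
  shows "expectation (\<lambda>\<omega>. cheb_U k (cos (\<theta> p \<omega>))) = 0"
proof -
  have rv [measurable]: "\<theta> p \<in> borel_measurable M"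
    using assms by (auto simp: sato_tate_family_def indep_vars_def)
  let ?d = "\<lambda>x. indicator {0..pi} x * (2 / pi * (sin x)\<^sup>2) :: real"
  let ?F = "\<lambda>x. 2 / pi * (sin (real k * x) / (2 * real k)
      - sin ((real k + 2) * x) / (2 * (real k + 2)))"
  let ?f = "\<lambda>x. 2 / pi * (cos (real k * x) / 2 - cos ((real k + 2) * x) / 2)"
  have "expectation (\<lambda>\<omega>. cheb_U k (cos (\<theta> p \<omega>))) = (\<integral>x. cheb_U k (cos x) \<partial>distr M borel (\<theta> p))"
    by (subst integral_distr) auto
  also have "\<dots> = (\<integral>x. ?d x * cheb_U k (cos x) \<partial>lborel)"
    unfolding distr_sato_tate[OF assms(1,2)]
    by (subst integral_density) auto
  also have "\<dots> = (\<integral>x. ?f x * indicator {0..pi} x \<partial>lborel)"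
  proof (rule Bochner_Integration.integral_cong[OF refl])
    fix x :: real
    have "(sin x)\<^sup>2 * cheb_U k (cos x) = sin x * sin (real (Suc k) * x)"
      by (simp only: power2_eq_square mult.assoc sin_times_cheb_U)
    also have "\<dots> = cos (real k * x) / 2 - cos ((real k + 2) * x) / 2"
      using cos_diff[of "real (Suc k) * x" x] cos_add[of "real (Suc k) * x" x]
      by (simp add: algebra_simps)
    finally show "?d x * cheb_U k (cos x) = ?f x * indicator {0..pi} x"
      by (simp add: mult_ac)
  qed
  also have "\<dots> = ?F pi - ?F 0"
  proof (rule has_bochner_integral_integral_eq, rule has_bochner_integral_FTC_Icc_real)
    have *: "((\<lambda>x. sin (c * x) / (2 * c)) has_real_derivative cos (c * x) / 2) (at x)"
      if "c \<noteq> 0" for c x :: real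
      using that by (auto intro!: derivative_eq_intros)
    show "DERIV ?F x :> ?f x" for x
      by (intro DERIV_cmult DERIV_diff *) (use assms(3) in auto)
  qed (auto intro!: continuous_intros)
  also have "\<dots> = 0"
    using sin_npi[of k] sin_npi[of "k + 2"] by (simp add: add.commute)
  finally show ?thesis .
qed

section \<open>Exponential moments of the martingale of friable sums\<close>

text \<open>Presents the sum as a function on the product space over \<open>P\<close>, the setting
  in which blocks of angles are independent.\<close>

lemma friable_sum_restrict:
  "Q \<subseteq> P \<Longrightarrow> friable_sum (restrict t P) Q N = friable_sum t Q N"
  unfolding friable_sum_def hecke_lambda_def
  by (intro sum.cong prod.cong refl arg_cong2[where f="(/)"]) auto

lemma measurable_friable_sum [measurable]:
  assumes "Q \<subseteq> P"
  shows "(\<lambda>t. friable_sum t Q N) \<in> borel_measurable (PiM P (\<lambda>_. borel))"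
  unfolding friable_sum_def hecke_lambda_def
proof (intro borel_measurable_sum borel_measurable_divide borel_measurable_prod borel_measurable_const)
  fix n q assume "n \<in> {n. n \<in> {1..N} \<and> prime_factors n \<subseteq> Q}" "q \<in> prime_factors n"
  then have "q \<in> P" using assms by auto
  then show "(\<lambda>t. cheb_U (multiplicity q n) (cos (t q))) \<in> borel_measurable (PiM P (\<lambda>_. borel))"
    by measurable
qed

lemma (in prob_space) measurable_friable_sum_sato_tate:
  assumes "sato_tate_family M \<theta>" "P \<subseteq> {p. prime p}"
  shows "(\<lambda>\<omega>. friable_sum (\<lambda>p. \<theta> p \<omega>) P N) \<in> borel_measurable M"
proof -
  have rv [measurable]: "\<theta> p \<in> borel_measurable M" if "p \<in> P" for p
    using assms that by (auto simp: sato_tate_family_def indep_vars_def)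
  have "(\<lambda>\<omega>. restrict (\<lambda>p. \<theta> p \<omega>) P) \<in> measurable M (PiM P (\<lambda>_. borel))"
    by (intro measurable_restrict rv)
  from measurable_compose[OF this measurable_friable_sum[OF order_refl]]
  show ?thesis by (simp add: friable_sum_restrict)
qed

text \<open>The martingale property without conditional expectations: the blocks \<open>P\<close>
  and \<open>{p}\<close> are independent, so the expectation factors and the Chebyshev factor has
  mean zero. Boundedness supplies integrability.\<close>

lemma (in prob_space) expectation_independent_of_sato_tate:
  assumes st: "sato_tate_family M \<theta>" and P: "P \<subseteq> {p. prime p}" "prime p" "p \<notin> P"
    and h [measurable]: "h \<in> borel_measurable (PiM P (\<lambda>_. borel))"
    and bnd: "\<And>\<omega>. \<omega> \<in> space M \<Longrightarrow> \<bar>h (restrict (\<lambda>p. \<theta> p \<omega>) P)\<bar> \<le> b" and "k \<ge> 1"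
  shows "expectation (\<lambda>\<omega>. h (restrict (\<lambda>p. \<theta> p \<omega>) P) * cheb_U k (cos (\<theta> p \<omega>))) = 0" (is ?eq)
    and "integrable M (\<lambda>\<omega>. h (restrict (\<lambda>p. \<theta> p \<omega>) P) * cheb_U k (cos (\<theta> p \<omega>)))" (is ?int)
proof -
  have rv: "\<theta> q \<in> borel_measurable M" if "prime q" for q
    using st that by (auto simp: sato_tate_family_def indep_vars_def)
  note [measurable] = rv[OF P(2)]
  have [measurable]: "(\<lambda>\<omega>. restrict (\<lambda>p. \<theta> p \<omega>) P) \<in> measurable M (PiM P (\<lambda>_. borel))"
    using P by (intro measurable_restrict rv) auto
  have "indep_vars (\<lambda>_. borel) \<theta> {p. prime p}" using st by (simp add: sato_tate_family_def)
  from indep_var_restrict[OF this, of P "{p}"] P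
  have "indep_var (PiM P (\<lambda>_. borel)) (\<lambda>\<omega>. restrict (\<lambda>p. \<theta> p \<omega>) P)
      (PiM {p} (\<lambda>_. borel)) (\<lambda>\<omega>. restrict (\<lambda>p. \<theta> p \<omega>) {p})" by auto
  from indep_var_compose[OF this h, of "\<lambda>t. cheb_U k (cos (t p))" borel]
  have ind: "indep_var borel (\<lambda>\<omega>. h (restrict (\<lambda>p. \<theta> p \<omega>) P)) borel (\<lambda>\<omega>. cheb_U k (cos (\<theta> p \<omega>)))"
    by (simp add: o_def)
  have 1: "integrable M (\<lambda>\<omega>. h (restrict (\<lambda>p. \<theta> p \<omega>) P))"
    using bnd by (intro integrable_const_bound[where B=b] AE_I2) auto
  have 2: "integrable M (\<lambda>\<omega>. cheb_U k (cos (\<theta> p \<omega>)))"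
    using abs_cheb_U_cos_le[of k] by (intro integrable_const_bound[where B="real k + 1"] AE_I2) auto
  show ?eq using indep_var_lebesgue_integral[OF ind 1 2]
    by (simp add: expectation_cheb_U_sato_tate[OF st P(2) assms(7)])
  show ?int by (rule indep_var_integrable[OF ind 1 2])
qed

text \<open>The linear term is kept because its weighted expectation will vanish, and the quadratic
  one is made deterministic through \<open>c\<close>.\<close>

lemma exp_minus_le_quadratic:
  fixes d :: real
  assumes "\<bar>d\<bar> \<le> c" "c \<le> 1"
  shows "exp (- d) \<le> 1 - d + c\<^sup>2"
proof -
  have "exp (- d) \<le> 1 - d + d\<^sup>2"
  proof (cases "d \<le> 0")
    case True
    then show ?thesis using exp_bound[of "- d"] assms by simp
  next
    case False
    have "1 - d + d\<^sup>2 \<ge> 1 / (1 + d)"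
      using False by (simp add: field_simps power2_eq_square)
    moreover have "exp (- d) \<le> 1 / (1 + d)"
      using False exp_ge_add_one_self[of d] by (simp add: exp_minus inverse_eq_divide frac_le)
    ultimately show ?thesis by linarith
  qed
  moreover have "d\<^sup>2 \<le> c\<^sup>2" using assms(1) by (metis abs_ge_zero power2_abs power_mono)
  ultimately show ?thesis by linarith
qed

lemma primes_upto_prime: "q \<in> primes_upto n \<Longrightarrow> prime q"
  by (simp add: primes_upto_def)

text \<open>Azuma's argument, adjoining one integer at a time; composite integers leave the sum
  unchanged. A prime \<open>p\<close> multiplies the moment by at most
  \<open>1 + c\<^sup>2 \<le> exp (c\<^sup>2)\<close> with \<open>c = 8 * s * B / p\<close>. The
  exponent is summed over all integers beyond \<open>y\<close>, which is already small
  enough.\<close>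

lemma (in prob_space) exp_moment_friable_sum:
  fixes \<theta> :: "nat \<Rightarrow> 'a \<Rightarrow> real" and N :: nat
  defines "T \<equiv> \<lambda>n \<omega>. friable_sum (\<lambda>p. \<theta> p \<omega>) (primes_upto n) N"
  assumes st: "sato_tate_family M \<theta>"
    and B: "\<And>n. n \<le> X \<Longrightarrow> (\<Prod>q\<in>primes_upto n. 1 / (1 - 1 / real q)\<^sup>2) \<le> B"
    and s: "0 \<le> s" "8 * s * B \<le> real y + 1" and "y \<le> X"
  shows "expectation (\<lambda>\<omega>. exp (- (s * (T X \<omega> - T y \<omega>)))) \<le> exp (\<Sum>k\<in>{y<..X}. (8 * s * B / real k)\<^sup>2)"
    and "integrable M (\<lambda>\<omega>. exp (- (s * (T X \<omega> - T y \<omega>))))"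
proof -
  have T_meas [measurable]: "T n \<in> borel_measurable M" for n
    unfolding T_def by (intro measurable_friable_sum_sato_tate[OF st]) (auto simp: primes_upto_def)
  have T_bound: "\<bar>friable_sum t (primes_upto n) K\<bar> \<le> B" if "n \<le> X" for t n K
    using abs_friable_sum_le[where t=t and P="primes_upto n" and N=K] B[OF that]
    by (force simp: primes_upto_prime)
  have E_bound: "\<bar>exp (- (s * (friable_sum t (primes_upto n) K - friable_sum t (primes_upto y) K)))\<bar>
      \<le> exp (s * (2 * B))"
    if "n \<le> X" for n t K
  proof -
    have "- (s * (friable_sum t (primes_upto n) K - friable_sum t (primes_upto y) K))
        = s * (friable_sum t (primes_upto y) K - friable_sum t (primes_upto n) K)"
      by (simp add: algebra_simps)
    also have "\<dots> \<le> s * (2 * B)"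
      using T_bound[OF that, of t K] T_bound[OF \<open>y \<le> X\<close>, of t K] s(1) by (intro mult_left_mono) auto
    finally show ?thesis by simp
  qed
  have int: "integrable M (\<lambda>\<omega>. exp (- (s * (T n \<omega> - T y \<omega>))))" if "n \<le> X" for n
  proof (rule integrable_const_bound[where B="exp (s * (2 * B))"])
    show "AE \<omega> in M. norm (exp (- (s * (T n \<omega> - T y \<omega>)))) \<le> exp (s * (2 * B))"
      using E_bound[OF that] by (intro AE_I2) (simp add: T_def)
  qed measurable
  from int[of X] show "integrable M (\<lambda>\<omega>. exp (- (s * (T X \<omega> - T y \<omega>))))" by simp
  have "n \<le> X \<Longrightarrow> expectation (\<lambda>\<omega>. exp (- (s * (T n \<omega> - T y \<omega>))))
      \<le> exp (\<Sum>k\<in>{y<..n}. (8 * s * B / real k)\<^sup>2)"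
    if "y \<le> n" for n
    using that
  proof (induction n rule: dec_induct)
    case base
    then show ?case by (simp add: prob_space)
  next
    case (step n)
    define p where "p = Suc n"
    define c where "c = 8 * s * B / real p"
    define Z where "Z = (\<lambda>\<omega>. exp (- (s * (T n \<omega> - T y \<omega>))))"
    have n: "n \<le> X" "y \<le> n" using step by auto
    have Z_int: "integrable M Z" using int[OF n(1)] by (simp add: Z_def)
    have IH: "expectation Z \<le> exp (\<Sum>k\<in>{y<..n}. (8 * s * B / real k)\<^sup>2)"
      using step.IH n by (simp add: Z_def)
    have "{y<..p} = insert p {y<..n}" using n by (auto simp: p_def)
    then have sum_eq: "(\<Sum>k\<in>{y<..p}. (8 * s * B / real k)\<^sup>2)
        = c\<^sup>2 + (\<Sum>k\<in>{y<..n}. (8 * s * B / real k)\<^sup>2)"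
      by (simp add: c_def p_def)
    have "expectation (\<lambda>\<omega>. exp (- (s * (T p \<omega> - T y \<omega>)))) \<le> exp (\<Sum>k\<in>{y<..p}. (8 * s * B / real k)\<^sup>2)"
    proof (cases "prime p")
      case False
      then have "T p = T n" by (simp add: T_def p_def primes_upto_Suc)
      then have "expectation (\<lambda>\<omega>. exp (- (s * (T p \<omega> - T y \<omega>)))) = expectation Z" by (simp add: Z_def)
      also note IH
      also have "exp (\<Sum>k\<in>{y<..n}. (8 * s * B / real k)\<^sup>2) \<le> exp (\<Sum>k\<in>{y<..p}. (8 * s * B / real k)\<^sup>2)"
        unfolding sum_eq by simp
      finally show ?thesis .
    next
      case True
      define P where "P = primes_upto n"
      have P: "finite P" "\<And>q. q \<in> P \<Longrightarrow> prime q" "p \<notin> P" "primes_upto p = insert p P" "primes_upto y \<subseteq> P"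
        using True n by (auto simp: P_def p_def primes_upto_Suc primes_upto_prime primes_upto_mono)
           (auto simp: primes_upto_def)
      \<comment> \<open>The earlier exponential times one inner sum, as a function of the angles in
        \<open>P\<close> alone.\<close>
      define h where "h = (\<lambda>k t. exp (- (s * (friable_sum t P N - friable_sum t (primes_upto y) N)))
          * friable_sum t P (N div p ^ k))"
      have h_meas: "h k \<in> borel_measurable (PiM P (\<lambda>_. borel))" for k
        using P(5) unfolding h_def by measurable
      have h_eq: "h k (restrict (\<lambda>p. \<theta> p \<omega>) P) = Z \<omega> * friable_sum (\<lambda>p. \<theta> p \<omega>) P (N div p ^ k)" for k \<omega>
        using P(5) by (simp add: h_def friable_sum_restrict Z_def T_def P_def)
      have h_bound: "\<bar>h k (restrict (\<lambda>p. \<theta> p \<omega>) P)\<bar> \<le> exp (s * (2 * B)) * B" for k \<omega>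
        unfolding h_def abs_mult P_def using n
        by (intro mult_mono E_bound T_bound) auto
      have orth: "expectation (\<lambda>\<omega>. h k (restrict (\<lambda>p. \<theta> p \<omega>) P) * cheb_U k (cos (\<theta> p \<omega>))) = 0"
        "integrable M (\<lambda>\<omega>. h k (restrict (\<lambda>p. \<theta> p \<omega>) P) * cheb_U k (cos (\<theta> p \<omega>)))" if "k \<ge> 1" for k
        using P(2) by (intro expectation_independent_of_sato_tate[OF st _ True P(3) h_meas h_bound that]; auto)+
      define D where "D = (\<lambda>\<omega>. T p \<omega> - T n \<omega>)"
      \<comment> \<open>Expanding the difference at \<open>p\<close> writes the product as a
        combination of terms whose expectations vanish.\<close>
      have ZD: "Z \<omega> * D \<omega> = (\<Sum>k=1..N. 1 / real p ^ k * (h k (restrict (\<lambda>p. \<theta> p \<omega>) P)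
          * cheb_U k (cos (\<theta> p \<omega>))))" for \<omega>
        unfolding D_def T_def P(4) P_def[symmetric] friable_sum_insert_diff[OF True P(3)] sum_distrib_left h_eq
        by (intro sum.cong refl) simp
      have ZD_int: "integrable M (\<lambda>\<omega>. Z \<omega> * D \<omega>)"
        unfolding ZD by (intro Bochner_Integration.integrable_sum integrable_mult_right orth) auto
      have ZD0: "expectation (\<lambda>\<omega>. Z \<omega> * D \<omega>) = 0"
        unfolding ZD by (subst Bochner_Integration.integral_sum)
          (auto intro!: integrable_mult_right orth sum.neutral simp: orth)
      have B0: "0 \<le> B" using T_bound[of 0] by (meson abs_ge_zero order_trans zero_le)
      \<comment> \<open>Here \<open>p = n + 1 \<ge> y + 1\<close>, which is what the upper bound on
        \<open>8 * s * B\<close> is meant for.\<close>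
      have c1: "c \<le> 1"
        using s n by (simp add: c_def p_def)
      have sD: "\<bar>s * D \<omega>\<bar> \<le> c" for \<omega>
      proof -
        have "\<bar>D \<omega>\<bar> \<le> 8 / real p * (\<Prod>q\<in>P. 1 / (1 - 1 / real q)\<^sup>2)"
          unfolding D_def T_def P(4) P_def[symmetric]
          by (intro abs_friable_sum_insert_diff_le True P)
        also have "\<dots> \<le> 8 / real p * B" using B[OF n(1)] by (intro mult_left_mono) (auto simp: P_def)
        finally have "s * \<bar>D \<omega>\<bar> \<le> s * (8 / real p * B)" using s(1) by (rule mult_left_mono)
        then show ?thesis using s(1) by (simp add: abs_mult c_def mult_ac)
      qed
      have "expectation (\<lambda>\<omega>. exp (- (s * (T p \<omega> - T y \<omega>))))
          \<le> expectation (\<lambda>\<omega>. (1 + c\<^sup>2) * Z \<omega> - s * (Z \<omega> * D \<omega>))"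
      proof (rule integral_mono)
        show "integrable M (\<lambda>\<omega>. exp (- (s * (T p \<omega> - T y \<omega>))))" using int[of p] step.prems
          by (simp add: p_def)
        show "integrable M (\<lambda>\<omega>. (1 + c\<^sup>2) * Z \<omega> - s * (Z \<omega> * D \<omega>))"
          using Z_int ZD_int by (intro Bochner_Integration.integrable_diff integrable_mult_right)
        fix \<omega>
        have "exp (- (s * (T p \<omega> - T y \<omega>))) = Z \<omega> * exp (- (s * D \<omega>))"
          by (simp add: Z_def D_def algebra_simps flip: exp_add)
        also have "\<dots> \<le> Z \<omega> * (1 - s * D \<omega> + c\<^sup>2)"
          by (intro mult_left_mono exp_minus_le_quadratic sD c1) (simp add: Z_def)
        also have "\<dots> = (1 + c\<^sup>2) * Z \<omega> - s * (Z \<omega> * D \<omega>)" by (simp add: algebra_simps)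
        finally show "exp (- (s * (T p \<omega> - T y \<omega>))) \<le> (1 + c\<^sup>2) * Z \<omega> - s * (Z \<omega> * D \<omega>)" .
      qed
      also have "\<dots> = (1 + c\<^sup>2) * expectation Z"
        using Z_int ZD_int by (simp add: ZD0)
      also have "\<dots> \<le> exp (c\<^sup>2) * exp (\<Sum>k\<in>{y<..n}. (8 * s * B / real k)\<^sup>2)"
        using IH by (intro mult_mono exp_ge_add_one_self) (auto simp: Z_def)
      finally show ?thesis unfolding sum_eq exp_add .
    qed
    then show ?case by (simp add: p_def)
  qed
  from this[OF \<open>y \<le> X\<close>] show "expectation (\<lambda>\<omega>. exp (- (s * (T X \<omega> - T y \<omega>))))
      \<le> exp (\<Sum>k\<in>{y<..X}. (8 * s * B / real k)\<^sup>2)"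
    by simp
qed

section \<open>Chernoff bound for the full sum\<close>

lemma sum_inverse_squares_le:
  fixes y X :: nat
  assumes "0 < y" "y \<le> X"
  shows "(\<Sum>k\<in>{y<..X}. 1 / (real k)\<^sup>2) \<le> 1 / real y - 1 / real X"
  using assms(2)
proof (induction X rule: dec_induct)
  case (step n)
  have "{y<..Suc n} = insert (Suc n) {y<..n}" using step by auto
  moreover have "1 / (real (Suc n))\<^sup>2 \<le> 1 / real n - 1 / real (Suc n)"
  proof -
    have "n > 0" using step assms(1) by simp
    then have "1 / real n - 1 / real (Suc n) = 1 / (real n * real (Suc n))" by (simp add: field_simps)
    moreover have "1 / (real (Suc n))\<^sup>2 \<le> 1 / (real n * real (Suc n))"
      using \<open>n > 0\<close> unfolding power2_eq_square by (intro divide_left_mono mult_right_mono) auto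
    ultimately show ?thesis by simp
  qed
  ultimately show ?case using step by simp
qed simp

text \<open>If the full sum is negative, the increment beyond \<open>y\<close> is below
  \<open>- \<tau>\<close>; the exponential moment makes this improbable.\<close>

lemma (in prob_space) prob_friable_sum_neg_le:
  fixes \<theta> :: "nat \<Rightarrow> 'a \<Rightarrow> real" and N :: nat
  defines "T \<equiv> \<lambda>n \<omega>. friable_sum (\<lambda>p. \<theta> p \<omega>) (primes_upto n) N"
  assumes st: "sato_tate_family M \<theta>"
    and B: "\<And>n. n \<le> X \<Longrightarrow> (\<Prod>q\<in>primes_upto n. 1 / (1 - 1 / real q)\<^sup>2) \<le> B"
    and "B > 0" "0 < y" "y \<le> X"
    and \<tau>: "\<And>\<omega>. \<omega> \<in> space M \<Longrightarrow> \<tau> \<le> T y \<omega>"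
  shows "prob {\<omega> \<in> space M. T X \<omega> < 0} \<le> exp 1 * exp (- (sqrt y * \<tau> / (8 * B)))"
proof -
  \<comment> \<open>With this \<open>s\<close> the scaled difference at \<open>k\<close> is at most
    \<open>sqrt y / k\<close>, and the squares over \<open>k > y\<close> sum to at most
    \<open>1\<close>. This is the source of the factor \<open>exp 1\<close>.\<close>
  define s where "s = sqrt y / (8 * B)"
  have s0: "0 \<le> s" using \<open>B > 0\<close> by (simp add: s_def)
  have sB: "8 * s * B = sqrt y" using \<open>B > 0\<close> by (simp add: s_def)
  have "sqrt y \<le> sqrt ((real y + 1)\<^sup>2)"
    by (intro real_sqrt_le_mono) (simp add: power2_eq_square algebra_simps)
  then have sB_le: "8 * s * B \<le> real y + 1" unfolding sB by simp
  have T_meas [measurable]: "T n \<in> borel_measurable M" for n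
    unfolding T_def by (intro measurable_friable_sum_sato_tate[OF st]) (auto simp: primes_upto_def)
  have mom: "expectation (\<lambda>\<omega>. exp (- (s * (T X \<omega> - T y \<omega>)))) \<le> exp (\<Sum>k\<in>{y<..X}. (8 * s * B / real k)\<^sup>2)"
    unfolding T_def by (rule exp_moment_friable_sum(1)[OF st B s0 sB_le \<open>y \<le> X\<close>])
  have mom_int: "integrable M (\<lambda>\<omega>. exp (- (s * (T X \<omega> - T y \<omega>))))"
    unfolding T_def by (rule exp_moment_friable_sum(2)[OF st B s0 sB_le \<open>y \<le> X\<close>])
  have "(\<Sum>k\<in>{y<..X}. (8 * s * B / real k)\<^sup>2) = real y * (\<Sum>k\<in>{y<..X}. 1 / (real k)\<^sup>2)"
    unfolding sB by (simp add: power_divide sum_distrib_left)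
  also have "\<dots> \<le> real y * (1 / real y - 1 / real X)"
    using \<open>0 < y\<close> \<open>y \<le> X\<close> by (intro mult_left_mono sum_inverse_squares_le) auto
  also have "\<dots> \<le> 1" using \<open>0 < y\<close> by (simp add: right_diff_distrib)
  finally have sum1: "(\<Sum>k\<in>{y<..X}. (8 * s * B / real k)\<^sup>2) \<le> 1" .
  have "{\<omega> \<in> space M. T X \<omega> < 0} \<inter> space M = {\<omega> \<in> space M. T X \<omega> < 0}" by auto
  then have "prob {\<omega> \<in> space M. T X \<omega> < 0} = expectation (indicator {\<omega> \<in> space M. T X \<omega> < 0})"
    by simp
  also have "\<dots> \<le> expectation (\<lambda>\<omega>. exp (- (s * \<tau>)) * exp (- (s * (T X \<omega> - T y \<omega>))))"
  proof (rule integral_mono)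
    show "integrable M (\<lambda>\<omega>. exp (- (s * \<tau>)) * exp (- (s * (T X \<omega> - T y \<omega>))))"
      by (intro integrable_mult_right mom_int)
    show "integrable M (indicator {\<omega> \<in> space M. T X \<omega> < 0} :: _ \<Rightarrow> real)"
      by (intro integrable_real_indicator) (auto simp: emeasure_eq_measure)
    fix \<omega> assume "\<omega> \<in> space M"
    show "indicator {\<omega> \<in> space M. T X \<omega> < 0} \<omega> \<le> exp (- (s * \<tau>)) * exp (- (s * (T X \<omega> - T y \<omega>)))"
    proof (cases "T X \<omega> < 0")
      case True
      have "s * (\<tau> + (T X \<omega> - T y \<omega>)) \<le> s * 0"
        using s0 True \<tau>[OF \<open>\<omega> \<in> space M\<close>] by (intro mult_left_mono) auto
      then have "1 \<le> exp (- (s * \<tau>) + - (s * (T X \<omega> - T y \<omega>)))"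
        unfolding one_le_exp_iff by (simp add: algebra_simps)
      then show ?thesis unfolding exp_add using \<open>\<omega> \<in> space M\<close> True by simp
    qed simp
  qed
  also have "\<dots> = exp (- (s * \<tau>)) * expectation (\<lambda>\<omega>. exp (- (s * (T X \<omega> - T y \<omega>))))" by simp
  also have "\<dots> \<le> exp (- (s * \<tau>)) * exp 1"
    using order_trans[OF mom] sum1 by (intro mult_left_mono) auto
  finally show ?thesis by (simp add: s_def mult.commute)
qed

section \<open>Choice of the friability parameter\<close>

lemma euler_product_upper:
  assumes "finite P" "\<And>q. q \<in> P \<Longrightarrow> prime q"
  shows "(\<Prod>q\<in>P. 1 / (1 - 1 / real q)\<^sup>2) \<le> exp (8 * (\<Sum>q\<in>P. 1 / real q))"
proof -
  have "(\<Prod>q\<in>P. 1 / (1 - 1 / real q)\<^sup>2) \<le> (\<Prod>q\<in>P. exp (8 * (1 / real q)))"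
  proof (intro prod_mono conjI inverse_square_one_minus_le_exp)
    fix q assume "q \<in> P"
    then show "1 / real q \<le> 3 / 4"
      using prime_ge_2_nat[OF assms(2), of q] by (simp add: field_simps)
  qed auto
  then show ?thesis by (simp add: exp_sum assms(1) sum_distrib_left)
qed

lemma euler_product_lower:
  assumes "finite P"
  shows "exp (- 2 * (\<Sum>q\<in>P. 1 / real q)) \<le> (\<Prod>q\<in>P. 1 / (1 + 1 / real q)\<^sup>2)"
proof -
  have "(\<Prod>q\<in>P. exp (- 2 * (1 / real q))) \<le> (\<Prod>q\<in>P. 1 / (1 + 1 / real q)\<^sup>2)"
  proof (intro prod_mono conjI)
    fix q
    have "(1 + 1 / real q)\<^sup>2 \<le> (exp (1 / real q))\<^sup>2"
      by (intro power_mono exp_ge_add_one_self) auto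
    then have "1 / (exp (1 / real q))\<^sup>2 \<le> 1 / (1 + 1 / real q)\<^sup>2"
      by (intro divide_left_mono mult_pos_pos zero_less_power) (auto simp: add_pos_nonneg)
    then show "exp (- 2 * (1 / real q)) \<le> 1 / (1 + 1 / real q)\<^sup>2"
      by (simp add: exp_minus inverse_eq_divide flip: exp_double)
  qed auto
  then show ?thesis by (simp add: exp_sum assms sum_distrib_left)
qed

text \<open>With \<open>\<delta> = 1 / ln w\<close> one has \<open>p powr \<delta> \<le> exp 1 \<le> 3\<close> for all \<open>p \<le> w\<close>.\<close>

lemma friable_sum_lower_bound_log:
  fixes x w :: real
  defines "W \<equiv> \<Sum>q\<in>primes_upto (nat \<lfloor>w\<rfloor>). 1 / real q"
  assumes "exp 2 \<le> w" "0 < x"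
  shows "friable_sum t (primes_upto (nat \<lfloor>w\<rfloor>)) (nat \<lfloor>x\<rfloor>)
    \<ge> exp (- 2 * W) - exp (24 * W - ln x / ln w)"
proof -
  let ?P = "primes_upto (nat \<lfloor>w\<rfloor>)"
  define \<delta> where "\<delta> = 1 / ln w"
  have w0: "w > 0" using assms(2) by (rule less_le_trans[OF exp_gt_zero])
  have lnw: "ln w \<ge> 2" using assms(2) w0 by (simp add: ln_ge_iff)
  then have \<delta>: "0 < \<delta>" "\<delta> \<le> 1 / 2" by (auto simp: \<delta>_def field_simps)
  have le_w: "real q \<le> w" if "q \<in> ?P" for q
    using that w0 by (auto simp: primes_upto_def le_nat_iff le_floor_iff)
  have "(\<Prod>p\<in>?P. 1 / (1 - real p powr (\<delta> - 1))\<^sup>2) \<le> (\<Prod>p\<in>?P. exp (24 * (1 / real p)))"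
  proof (intro prod_mono conjI)
    fix p assume p: "p \<in> ?P"
    then have p2: "2 \<le> real p" using prime_ge_2_nat[OF primes_upto_prime] by auto
    \<comment> \<open>First the argument is brought below \<open>3 / 4\<close>; afterwards the bound
      \<open>3 / p\<close> turns the constant \<open>8\<close> into \<open>24\<close>.\<close>
    have "real p powr (\<delta> - 1) \<le> real p powr - (1 / 2)" using p2 \<delta> by (intro powr_mono) auto
    also have "\<dots> \<le> 2 powr - (1 / 2)" using p2 by (intro powr_mono2') auto
    also have "\<dots> = 1 / sqrt 2" by (simp add: powr_minus powr_half_sqrt inverse_eq_divide)
    also have "\<dots> \<le> 3 / 4"
      using real_le_rsqrt[of "4 / 3" 2] by (simp add: power2_eq_square field_simps)
    finally have "1 / (1 - real p powr (\<delta> - 1))\<^sup>2 \<le> exp (8 * real p powr (\<delta> - 1))"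
      by (intro inverse_square_one_minus_le_exp) auto
    also have "real p powr (\<delta> - 1) \<le> 3 * (1 / real p)"
    proof -
      have "real p powr \<delta> \<le> w powr \<delta>" using le_w[OF p] \<delta> by (intro powr_mono2) auto
      also have "\<dots> = exp 1" using w0 lnw by (auto simp: powr_def \<delta>_def)
      also have "\<dots> \<le> 3" by (rule exp_le)
      finally show ?thesis using p2 by (simp add: powr_diff divide_right_mono)
    qed
    finally show "1 / (1 - real p powr (\<delta> - 1))\<^sup>2 \<le> exp (24 * (1 / real p))" by simp
  qed auto
  also have "\<dots> = exp (24 * W)" by (simp add: W_def exp_sum sum_distrib_left)
  finally have E: "(\<Prod>p\<in>?P. 1 / (1 - real p powr (\<delta> - 1))\<^sup>2) \<le> exp (24 * W)" .
  have "x powr - \<delta> * (\<Prod>p\<in>?P. 1 / (1 - real p powr (\<delta> - 1))\<^sup>2) \<le> x powr - \<delta> * exp (24 * W)"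
    using E by (intro mult_left_mono) auto
  also have "\<dots> = exp (24 * W - ln x / ln w)"
    using assms(3) by (simp add: powr_def \<delta>_def flip: exp_add)
  finally have "x powr - \<delta> * (\<Prod>p\<in>?P. 1 / (1 - real p powr (\<delta> - 1))\<^sup>2) \<le> exp (24 * W - ln x / ln w)" .
  moreover have "exp (- 2 * W) \<le> (\<Prod>q\<in>?P. 1 / (1 + 1 / real q)\<^sup>2)"
    unfolding W_def by (rule euler_product_lower) auto
  moreover have "x \<le> real (nat \<lfloor>x\<rfloor>) + 1" using assms(3) by linarith
  then have "(\<Prod>q\<in>?P. 1 / (1 + 1 / real q)\<^sup>2) - x powr - \<delta> * (\<Prod>p\<in>?P. 1 / (1 - real p powr (\<delta> - 1))\<^sup>2)
      \<le> friable_sum t ?P (nat \<lfloor>x\<rfloor>)"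
    using \<delta> assms(3) by (intro friable_sum_lower_bound) (auto simp: primes_upto_prime)
  ultimately show ?thesis by linarith
qed

theorem theorem1p3:
  fixes m :: nat
  shows "\<exists>C::real. C > 0 \<and>
    (\<forall>(M :: 'a measure) (\<theta> :: nat \<Rightarrow> 'a \<Rightarrow> real) (\<rho> :: 'a \<Rightarrow> nat \<Rightarrow> real).
      prob_space M \<longrightarrow> sato_tate_family M \<theta> \<longrightarrow>
      (\<forall>\<omega>\<in>space M. hecke_function m (\<lambda>p. \<theta> p \<omega>) (\<rho> \<omega>)) \<longrightarrow>
      (\<lambda>x::real. measure M {\<omega> \<in> space M. partial_sum m (\<rho> \<omega>) x < 0})
        \<in> O[at_top](\<lambda>x. exp (- exp (ln x / (C * ln (ln x))))))"
\<comment> \<open>As \<open>320 = 4 * 80\<close>, the target exponential is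
  \<open>w x powr (1 / 4)\<close>. The Chernoff bound offers nearly \<open>sqrt (w x)\<close>, and
  the surplus absorbs all powers of \<open>ln x\<close>.\<close>
proof (intro exI[of _ 320] conjI allI impI)
  fix M :: "'a measure" and \<theta> :: "nat \<Rightarrow> 'a \<Rightarrow> real" and \<rho> :: "'a \<Rightarrow> nat \<Rightarrow> real"
  assume "prob_space M" and st: "sato_tate_family M \<theta>"
    and \<rho>: "\<forall>\<omega>\<in>space M. hecke_function m (\<lambda>p. \<theta> p \<omega>) (\<rho> \<omega>)"
  interpret prob_space M by fact
  \<comment> \<open>The factor \<open>80\<close> gives
    \<open>ln x / ln (w x) = 80 * ln (ln x)\<close>. Reciprocal prime sums at most
    \<open>3 * ln (ln x)\<close> make the Rankin product at most \<open>ln x\<close> to the power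
    \<open>72\<close>, so the tail is at most the power \<open>-8\<close>, against \<open>-6\<close>
    for the main term.\<close>
  define w :: "real \<Rightarrow> real" where "w = (\<lambda>x. exp (ln x / (80 * ln (ln x))))"
  \<comment> \<open>The third condition compares the two exponents; \<open>w x - 1\<close> stands
    for the floor of \<open>w x\<close>, and each power of \<open>ln x\<close> is eventually below
    any fixed positive power of \<open>w x\<close>.\<close>
  have asymp: "\<forall>\<^sub>F x in at_top. exp 2 \<le> w x" "\<forall>\<^sub>F x in at_top. w x \<le> x"
    "\<forall>\<^sub>F x in at_top. exp (ln x / (320 * ln (ln x)))
        \<le> sqrt (w x - 1) * (exp (- 6 * ln (ln x)) / 2) / (8 * exp (24 * ln (ln x)))"
    "\<forall>\<^sub>F x::real in at_top. 1 \<le> ln (ln x)" "\<forall>\<^sub>F x::real in at_top. 3 \<le> x"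
    unfolding w_def by real_asymp+
  have "\<forall>\<^sub>F x in at_top. prob {\<omega> \<in> space M. partial_sum m (\<rho> \<omega>) x < 0}
      \<le> exp 1 * exp (- exp (ln x / (320 * ln (ln x))))"
    using asymp sum_inverse_primes_bound
  proof eventually_elim
    case (elim x)
    define N y where "N = nat \<lfloor>x\<rfloor>" and "y = nat \<lfloor>w x\<rfloor>"
    define l where "l = ln (ln x)"
    have W: "(\<Sum>q\<in>primes_upto n. 1 / real q) \<le> 3 * l" if "n \<le> N" for n
      using sum_mono2[OF finite_primes_upto primes_upto_mono[OF that], of "\<lambda>q. 1 / real q"] elim(6)
      by (simp add: N_def l_def)
    have B: "(\<Prod>q\<in>primes_upto n. 1 / (1 - 1 / real q)\<^sup>2) \<le> exp (24 * l)" if "n \<le> N" for n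
    proof -
      have "(\<Prod>q\<in>primes_upto n. 1 / (1 - 1 / real q)\<^sup>2) \<le> exp (8 * (\<Sum>q\<in>primes_upto n. 1 / real q))"
        by (rule euler_product_upper) (auto simp: primes_upto_prime)
      also have "\<dots> \<le> exp (24 * l)" using W[OF that] by simp
      finally show ?thesis .
    qed
    have w1: "w x \<ge> 1" using elim(1) by (smt (verit) one_le_exp_iff)
    then have y: "0 < y" "y \<le> N" "w x - 1 \<le> real y"
      using elim(2) by (auto simp: y_def N_def nat_mono floor_mono le_nat_iff le_floor_iff) linarith
    have lower: "exp (- 6 * l) / 2 \<le> friable_sum t (primes_upto y) N" for t
    proof -
      define V where "V = (\<Sum>q\<in>primes_upto y. 1 / real q)"
      have V: "V \<le> 3 * l" using W[OF y(2)] by (simp add: V_def)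
      have "ln x / ln (w x) = 80 * l" using elim by (simp add: w_def l_def field_simps)
      then have "exp (- 2 * V) - exp (24 * V - 80 * l) \<le> friable_sum t (primes_upto y) N"
        using friable_sum_lower_bound_log[OF elim(1), of x t] elim(5) by (simp add: V_def y_def N_def)
      moreover have "exp (- 6 * l) \<le> exp (- 2 * V)" using V by simp
      moreover have "exp (24 * V - 80 * l) \<le> exp (- 6 * l) / 2"
      proof -
        \<comment> \<open>The exponent is at most \<open>- 8 * l\<close>, and
          \<open>l \<ge> 1\<close> gives \<open>- 8 * l \<le> - 6 * l - 1\<close>.\<close>
        have "exp (24 * V - 80 * l) \<le> exp (- 6 * l + - 1)" using V elim(4) by (simp add: l_def)
        also have "\<dots> = exp (- 6 * l) * exp (- 1)" by (rule exp_add)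
        also have "\<dots> \<le> exp (- 6 * l) * (1 / 2)"
          using exp_ge_add_one_self[of 1] by (intro mult_left_mono) (auto simp: exp_minus field_simps)
        finally show ?thesis by simp
      qed
      ultimately show ?thesis by linarith
    qed
    have "prob {\<omega> \<in> space M. partial_sum m (\<rho> \<omega>) x < 0}
        = prob {\<omega> \<in> space M. friable_sum (\<lambda>p. \<theta> p \<omega>) (primes_upto N) N < 0}"
      using partial_sum_eq_friable_sum[OF bspec[OF \<rho>], of _ x]
      by (intro arg_cong[where f=prob] Collect_cong conj_cong refl) (simp add: N_def)
    also have "\<dots> \<le> exp 1 * exp (- (sqrt y * (exp (- 6 * l) / 2) / (8 * exp (24 * l))))"
      by (intro prob_friable_sum_neg_le st B y lower) auto
    also have "\<dots> \<le> exp 1 * exp (- exp (ln x / (320 * ln (ln x))))"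
    proof -
      have "sqrt (w x - 1) * (exp (- 6 * l) / 2) / (8 * exp (24 * l))
          \<le> sqrt y * (exp (- 6 * l) / 2) / (8 * exp (24 * l))"
        using y(3) by (intro divide_right_mono mult_right_mono real_sqrt_le_mono) auto
      with elim(3) show ?thesis by (simp add: l_def)
    qed
    finally show ?case .
  qed
  then show "(\<lambda>x. prob {\<omega> \<in> space M. partial_sum m (\<rho> \<omega>) x < 0})
      \<in> O[at_top](\<lambda>x. exp (- exp (ln x / (320 * ln (ln x)))))"
    by (intro bigoI[of _ "exp 1"]) simp
qed simp

end
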